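(* Let $f:\mathbb{R}^2\to\mathbb{R}$, $f(x_1,x_2)=x_1$, be the projection to the first coordinate. Let $\Gamma=\dot T^*\mathbb{R}$, so that $\mathcal{D}'_\Gamma(\mathbb{R})=\mathcal{D}'(\mathbb{R})$, and $f^*\Gamma=\{(x_1,x_2;\xi_1,0) : (x_1,x_2)\in\mathbb{R}^2,\ \xi_1\neq 0\}\subset\dot T^*\mathbb{R}^2$. Then the pull-back map $f^*:\mathcal{D}'_\Gamma(\mathbb{R})\to\mathcal{D}'_{f^*\Gamma}(\mathbb{R}^2)$ (that is, $u\mapsto u\otimes 1$) is not (topologically) continuous when both spaces carry the Hörmander topology.
   Context: For an open set $\Omega\subset\mathbb{R}^n$ write $\mathcal{D}(\Omega)=C_c^\infty(\Omega)$, $T^*\Omega=\Omega\times\mathbb{R}^n$ and $\dot T^*\Omega=\{(x;\xi)\in T^*\Omega : \xi\neq 0\}$. A cone in $\dot T^*\Omega$ is a subset $\Gamma$ such that $(x;\xi)\in\Gamma$ and $\lambda>0$ imply $(x;\lambda\xi)\in\Gamma$. For a closed cone $\Gamma$, $\mathcal{D}'_\Gamma(\Omega)=\{u\in\mathcal{D}'(\Omega) : \mathrm{WF}(u)\subset\Gamma\}$, where $\mathrm{WF}$ is the ($C^\infty$) wave front set. The Hörmander topology on $\mathcal{D}'_\Gamma(\Omega)$ is the locally convex topology defined by the seminorms (i) $\|u\|_\phi=|\langle u,\phi\rangle|$, $\phi\in\mathcal{D}(\Omega)$, and (ii) $\|u\|_{N,V,\chi}=\sup_{k\in V}(1+|k|)^N|\widehat{u\chi}(k)|$,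 where $N\ge 0$, $\chi\in\mathcal{D}(\Omega)$ and $V\subset\mathbb{R}^n$ is a closed cone with $(\operatorname{supp}\chi\times V)\cap\Gamma=\emptyset$. Here $\widehat{w}(k)=\langle w,e^{-ik\cdot x}\rangle$. *)

theory Defs
  imports "HOL-Analysis.Analysis"
begin

section \<open>Test functions\<close>

fun iter_partial :: "'a list \<Rightarrow> ('a::euclidean_space \<Rightarrow> complex) \<Rightarrow> 'a \<Rightarrow> complex" where
  "iter_partial [] \<phi> = \<phi>"
| "iter_partial (b # bs) \<phi> = (\<lambda>x. frechet_derivative (iter_partial bs \<phi>) (at x) b)"

text \<open>\<open>frechet_derivative\<close> is an arbitrary value where the function is not differentiable. The
  condition below excludes this: each partial derivative is formed only of a function that is
  itself required to be differentiable everywhere.\<close>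

definition smooth :: "('a::euclidean_space \<Rightarrow> complex) \<Rightarrow> bool" where
  "smooth \<phi> \<longleftrightarrow> (\<forall>bs x. set bs \<subseteq> Basis \<longrightarrow> iter_partial bs \<phi> differentiable (at x))"

definition supp :: "('a::euclidean_space \<Rightarrow> complex) \<Rightarrow> 'a set" where
  "supp \<phi> = closure {x. \<phi> x \<noteq> 0}"

text \<open>A test function on \<open>\<Omega>\<close> is represented by its extension by zero to the whole space.\<close>

definition test_functions :: "'a::euclidean_space set \<Rightarrow> ('a \<Rightarrow> complex) set" where
  "test_functions \<Omega> = {\<phi>. smooth \<phi> \<and> compact (supp \<phi>) \<and> supp \<phi> \<subseteq> \<Omega>}"


section \<open>Distributions\<close>

type_synonym 'a functional = "('a \<Rightarrow> complex) \<Rightarrow> complex"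

text \<open>Extensionality makes equality of functionals coincide with equality of distributions. The
  last condition is the usual estimate on every compact set, which is equivalent to continuity
  on \<open>\<D>(\<Omega>)\<close>; lists of at most \<open>m\<close> basis vectors play the role of the multi-indices of order at
  most \<open>m\<close>.\<close>

definition distributions :: "'a::euclidean_space set \<Rightarrow> 'a functional set" where
  "distributions \<Omega> =
     {u \<in> extensional (test_functions \<Omega>).
        (\<forall>\<phi>\<in>test_functions \<Omega>. \<forall>\<psi>\<in>test_functions \<Omega>. u (\<lambda>x. \<phi> x + \<psi> x) = u \<phi> + u \<psi>) \<and>
        (\<forall>c. \<forall>\<phi>\<in>test_functions \<Omega>. u (\<lambda>x. c * \<phi> x) = c * u \<phi>) \<and>
        (\<forall>K. compact K \<and> K \<subseteq> \<Omega> \<longrightarrow>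
           (\<exists>C m. \<forall>\<phi>\<in>test_functions \<Omega>. supp \<phi> \<subseteq> K \<longrightarrow>
              cmod (u \<phi>) \<le> C * (\<Sum>bs | set bs \<subseteq> Basis \<and> length bs \<le> m.
                                  SUP x. cmod (iter_partial bs \<phi> x))))}"

definition function_distribution ::
    "'a::euclidean_space set \<Rightarrow> ('a \<Rightarrow> complex) \<Rightarrow> 'a functional" where
  "function_distribution \<Omega> g = (\<lambda>\<phi>\<in>test_functions \<Omega>. LINT x|lborel. g x * \<phi> x)"

definition tensor_distribution ::
    "'a::euclidean_space set \<Rightarrow> 'b::euclidean_space set \<Rightarrow>
     'a functional \<Rightarrow> 'b functional \<Rightarrow> ('a \<times> 'b) functional" where
  "tensor_distribution \<Omega>\<^sub>1 \<Omega>\<^sub>2 u v =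
     (\<lambda>\<phi>\<in>test_functions (\<Omega>\<^sub>1 \<times> \<Omega>\<^sub>2). u (\<lambda>x. v (\<lambda>y. \<phi> (x, y))))"

text \<open>For a test function \<open>\<rho>\<close> the compactly supported distribution \<open>u\<rho>\<close> acts on all smooth
  functions, in particular on the exponentials \<open>exp (-i k \<bullet> x)\<close>. So
  \<open>fourier (localize u \<rho>) k\<close> is \<open>\<langle>u, \<rho> exp (-i k \<bullet> x)\<rangle>\<close>.\<close>

definition localize :: "'a functional \<Rightarrow> ('a \<Rightarrow> complex) \<Rightarrow> 'a functional" where
  "localize u \<rho> = (\<lambda>\<psi>. u (\<lambda>x. \<rho> x * \<psi> x))"

definition fourier :: "'a::euclidean_space functional \<Rightarrow> 'a \<Rightarrow> complex" where
  "fourier w k = w (\<lambda>x. exp (- \<i> * complex_of_real (k \<bullet> x)))"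


section \<open>Cones and wave front sets\<close>

text \<open>The library's \<open>cone\<close> also demands stability under multiplication by \<open>0\<close>, which is wrong for
  conic neighbourhoods of a covector and for cones in the punctured cotangent bundle. For closed
  sets of covectors the two notions agree.\<close>

definition positive_cone :: "'a::real_vector set \<Rightarrow> bool" where
  "positive_cone V \<longleftrightarrow> (\<forall>k\<in>V. \<forall>c>0. c *\<^sub>R k \<in> V)"

definition punctured_cotangent :: "'a::euclidean_space set \<Rightarrow> ('a \<times> 'a) set" where
  "punctured_cotangent \<Omega> = {(x, \<xi>). x \<in> \<Omega> \<and> \<xi> \<noteq> 0}"

definition WF :: "'a::euclidean_space set \<Rightarrow> 'a functional \<Rightarrow> ('a \<times> 'a) set" where
  "WF \<Omega> u =
     {(x, \<xi>) \<in> punctured_cotangent \<Omega>.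
        \<not> (\<exists>\<rho>\<in>test_functions \<Omega>. \<exists>V. \<rho> x \<noteq> 0 \<and> open V \<and> positive_cone V \<and> \<xi> \<in> V \<and>
             (\<forall>N::nat. \<exists>C. \<forall>k\<in>V. (1 + norm k) ^ N * cmod (fourier (localize u \<rho>) k) \<le> C))}"

definition distributions_WF ::
    "'a::euclidean_space set \<Rightarrow> ('a \<times> 'a) set \<Rightarrow> 'a functional set" where
  "distributions_WF \<Omega> \<Gamma> = {u \<in> distributions \<Omega>. WF \<Omega> u \<subseteq> \<Gamma>}"

text \<open>\<open>f\<^sup>*\<Gamma> = {(x; \<eta> \<circ> df\<^sub>x) : (f(x); \<eta>) \<in> \<Gamma>}\<close>; since covectors are identified with vectors by the
  inner product, \<open>\<eta> \<circ> df\<^sub>x\<close> becomes the adjoint of \<open>df\<^sub>x\<close> applied to \<open>\<eta>\<close>.\<close>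

definition pullback_cone ::
    "('a::euclidean_space \<Rightarrow> 'b::euclidean_space) \<Rightarrow> ('b \<times> 'b) set \<Rightarrow> ('a \<times> 'a) set" where
  "pullback_cone f \<Gamma> = {(x, adjoint (frechet_derivative f (at x)) \<eta>) | x \<eta>. (f x, \<eta>) \<in> \<Gamma>}"


section \<open>The Hoermander topology\<close>

text \<open>Seminorms take values in \<open>ennreal\<close>, so that the suprema are meaningful without first proving
  them finite, and the supremum over \<open>V = {}\<close> is \<open>0\<close>.\<close>

definition weak_seminorm :: "('a \<Rightarrow> complex) \<Rightarrow> 'a functional \<Rightarrow> ennreal" where
  "weak_seminorm \<phi> u = ennreal (cmod (u \<phi>))"

definition cone_seminorm ::
    "nat \<Rightarrow> 'a::euclidean_space set \<Rightarrow> ('a \<Rightarrow> complex) \<Rightarrow> 'a functional \<Rightarrow> ennreal" where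
  "cone_seminorm N V \<rho> u =
     (SUP k\<in>V. ennreal ((1 + norm k) ^ N * cmod (fourier (localize u \<rho>) k)))"

definition hormander_seminorms ::
    "'a::euclidean_space set \<Rightarrow> ('a \<times> 'a) set \<Rightarrow> ('a functional \<Rightarrow> ennreal) set" where
  "hormander_seminorms \<Omega> \<Gamma> =
     {weak_seminorm \<phi> | \<phi>. \<phi> \<in> test_functions \<Omega>} \<union>
     {cone_seminorm N V \<rho> | N V \<rho>. \<rho> \<in> test_functions \<Omega> \<and> closed V \<and> positive_cone V \<and>
        (supp \<rho> \<times> V) \<inter> \<Gamma> = {}}"

definition seminorm_topology ::
    "'a functional set \<Rightarrow> ('a functional \<Rightarrow> ennreal) set \<Rightarrow> 'a functional topology" where
  "seminorm_topology E P =
     topology_generated_by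
       {{v \<in> E. p (\<lambda>\<phi>. v \<phi> - u \<phi>) < ennreal \<epsilon>} | p u \<epsilon>. p \<in> P \<and> u \<in> E \<and> 0 < \<epsilon>}"

definition hormander_topology ::
    "'a::euclidean_space set \<Rightarrow> ('a \<times> 'a) set \<Rightarrow> 'a functional topology" where
  "hormander_topology \<Omega> \<Gamma> =
     seminorm_topology (distributions_WF \<Omega> \<Gamma>) (hormander_seminorms \<Omega> \<Gamma>)"

lemma topspace_hormander_topology:
  "topspace (hormander_topology \<Omega> \<Gamma>) = distributions_WF \<Omega> \<Gamma>"
proof -
  have "(\<lambda>_. 0) \<in> test_functions \<Omega>"
  proof -
    have "iter_partial bs (\<lambda>_::'a. 0) = (\<lambda>_. 0)" for bs :: "'a list"
      by (induction bs) auto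
    then show ?thesis by (simp add: test_functions_def smooth_def supp_def)
  qed
  then have "weak_seminorm (\<lambda>_. 0) \<in> hormander_seminorms \<Omega> \<Gamma>"
    by (auto simp: hormander_seminorms_def)
  moreover have "weak_seminorm (\<lambda>_. 0) (\<lambda>\<phi>. u \<phi> - u \<phi>) < ennreal 1" for u :: "'a functional"
    by (simp add: weak_seminorm_def)
  ultimately have "u \<in> \<Union>{{v \<in> distributions_WF \<Omega> \<Gamma>. p (\<lambda>\<phi>. v \<phi> - u \<phi>) < ennreal \<epsilon>} | p u \<epsilon>.
      p \<in> hormander_seminorms \<Omega> \<Gamma> \<and> u \<in> distributions_WF \<Omega> \<Gamma> \<and> 0 < \<epsilon>}"
    if "u \<in> distributions_WF \<Omega> \<Gamma>" for u
    using that
    by (intro UnionI[where X = "{v \<in> distributions_WF \<Omega> \<Gamma>.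
      weak_seminorm (\<lambda>_. 0) (\<lambda>\<phi>. v \<phi> - u \<phi>) < ennreal 1}"] CollectI
      exI[of _ "weak_seminorm (\<lambda>_. 0)"] exI[of _ u] exI[of _ 1] conjI refl) simp_all
  then show ?thesis
    unfolding hormander_topology_def seminorm_topology_def topology_generated_by_topspace
    by (intro equalityI subsetI) (assumption | blast)+
qed

end

theory Submission
  imports Defs
begin

text \<open>For tensor products, \<open>\<langle>u \<otimes> 1, (a \<otimes> b) exp (-i k \<bullet> x)\<rangle> = \<langle>u, a exp (-i k\<^sub>1 x)\<rangle> * F b(k\<^sub>2)\<close>, where
  \<open>F b\<close> is the Fourier transform of \<open>b\<close>. The first factor grows at most polynomially in \<open>k\<^sub>1\<close> and
  the second decays rapidly in \<open>k\<^sub>2\<close>, so the product decays rapidly on cones \<open>\<bar>k\<^sub>1\<bar> < c * \<bar>k\<^sub>2\<bar>\<close>; this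
  bounds the wave front set.

  On the source, the only closed cones away from the full cone lie in \<open>{0}\<close>, so the topology is the
  weak one, and a neighbourhood of \<open>0\<close> contains every \<open>u\<close> that vanishes on some finite set of
  functions. Continuity at \<open>0\<close>, for the seminorm of the cone \<open>\<bar>k\<^sub>1\<bar> \<le> \<bar>k\<^sub>2\<bar>\<close>, would therefore force
  finitely many linear conditions on \<open>u\<close> to imply \<open>\<langle>u, a exp (-i k x)\<rangle> = 0\<close> for all \<open>\<bar>k\<bar> \<le> 1\<close> (take
  \<open>k\<^sub>2 = 1\<close>). A suitable combination of point masses violates this.\<close>

section \<open>Smooth functions and test functions\<close>

lemma iter_partial_append: "iter_partial (bs @ cs) \<phi> = iter_partial bs (iter_partial cs \<phi>)"
  by (induction bs) auto

lemma frechet_derivative_eqI: "(f has_derivative f') (at x) \<Longrightarrow> frechet_derivative f (at x) = f'"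
  using frechet_derivative_at by metis

text \<open>By induction on the list, every iterated partial stays in \<open>S\<close>. Below,
  smoothness is thus shown by naming a family closed under first partials, with no formula for the
  higher ones.\<close>

lemma smooth_coinduct:
  assumes "\<phi> \<in> S"
    and diff: "\<And>\<phi> x. \<phi> \<in> S \<Longrightarrow> \<phi> differentiable (at x)"
    and closed: "\<And>\<phi> b. \<phi> \<in> S \<Longrightarrow> b \<in> Basis \<Longrightarrow> (\<lambda>x. frechet_derivative \<phi> (at x) b) \<in> S"
  shows "smooth \<phi>"
proof -
  have "iter_partial bs \<phi> \<in> S" if "set bs \<subseteq> Basis" for bs
    using that by (induction bs) (auto simp: assms(1) intro: closed)
  then show ?thesis
    by (auto simp: smooth_def intro: diff)
qed

lemma smooth_iter_partial:
  assumes "smooth \<phi>" "set bs \<subseteq> Basis"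
  shows "smooth (iter_partial bs \<phi>)"
  using assms by (auto simp: smooth_def simp flip: iter_partial_append)

lemma smooth_partial:
  assumes "smooth \<phi>" "b \<in> Basis"
  shows "smooth (\<lambda>x. frechet_derivative \<phi> (at x) b)"
  using smooth_iter_partial[of \<phi> "[b]"] assms by simp

lemma smooth_differentiable: "smooth \<phi> \<Longrightarrow> \<phi> differentiable (at x)"
  unfolding smooth_def by (drule spec[of _ "[]"]) simp

lemma smooth_has_derivative:
  "smooth \<phi> \<Longrightarrow> (\<phi> has_derivative frechet_derivative \<phi> (at x)) (at x)"
  using smooth_differentiable frechet_derivative_works by blast

lemma smooth_continuous_on: "smooth \<phi> \<Longrightarrow> continuous_on A \<phi>"
  by (simp add: continuous_at_imp_continuous_on differentiable_imp_continuous_within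
      smooth_differentiable)

text \<open>Iterating the Leibniz rule leaves the set of plain products, but not the algebra generated by
  the smooth functions, so \<open>smooth_coinduct\<close> applies to the latter.\<close>

inductive_set smooth_algebra :: "('a::euclidean_space \<Rightarrow> complex) set" where
  base: "smooth \<phi> \<Longrightarrow> \<phi> \<in> smooth_algebra"
| add: "\<phi> \<in> smooth_algebra \<Longrightarrow> \<psi> \<in> smooth_algebra \<Longrightarrow> (\<lambda>x. \<phi> x + \<psi> x) \<in> smooth_algebra"
| mult: "\<phi> \<in> smooth_algebra \<Longrightarrow> \<psi> \<in> smooth_algebra \<Longrightarrow> (\<lambda>x. \<phi> x * \<psi> x) \<in> smooth_algebra"

lemma frechet_derivative_add:
  fixes \<phi> \<psi> :: "'a::real_normed_vector \<Rightarrow> complex"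
  assumes "\<phi> differentiable (at x)" "\<psi> differentiable (at x)"
  shows "frechet_derivative (\<lambda>x. \<phi> x + \<psi> x) (at x) b
    = frechet_derivative \<phi> (at x) b + frechet_derivative \<psi> (at x) b"
  by (subst frechet_derivative_eqI[OF has_derivative_add])
    (use assms frechet_derivative_works in auto)

lemma frechet_derivative_mult:
  fixes \<phi> \<psi> :: "'a::real_normed_vector \<Rightarrow> complex"
  assumes "\<phi> differentiable (at x)" "\<psi> differentiable (at x)"
  shows "frechet_derivative (\<lambda>x. \<phi> x * \<psi> x) (at x) b
    = \<phi> x * frechet_derivative \<psi> (at x) b + frechet_derivative \<phi> (at x) b * \<psi> x"
  by (subst frechet_derivative_eqI[OF has_derivative_mult])
    (use assms frechet_derivative_works in auto)

lemma smooth_algebra_partial: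
  assumes "\<phi> \<in> smooth_algebra"
  shows "(\<forall>x. \<phi> differentiable (at x)) \<and>
    (\<forall>b\<in>Basis. (\<lambda>x. frechet_derivative \<phi> (at x) b) \<in> smooth_algebra)"
  using assms
proof induction
  case (base \<phi>)
  then show ?case
    by (auto intro: smooth_differentiable smooth_partial smooth_algebra.base)
next
  case (add \<phi> \<psi>)
  then show ?case
    by (auto simp: frechet_derivative_add intro!: smooth_algebra.add)
next
  case (mult \<phi> \<psi>)
  then show ?case
    by (auto simp: frechet_derivative_mult intro!: smooth_algebra.intros(2,3))
qed

lemma smooth_algebra_smooth: "\<phi> \<in> smooth_algebra \<Longrightarrow> smooth \<phi>"
  by (rule smooth_coinduct[of _ smooth_algebra]) (use smooth_algebra_partial in auto)

lemma smooth_add: "smooth \<phi> \<Longrightarrow> smooth \<psi> \<Longrightarrow> smooth (\<lambda>x. \<phi> x + \<psi> x)"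
  and smooth_mult: "smooth \<phi> \<Longrightarrow> smooth \<psi> \<Longrightarrow> smooth (\<lambda>x. \<phi> x * \<psi> x)"
  by (blast intro: smooth_algebra_smooth smooth_algebra.intros)+

lemma smooth_const: "smooth (\<lambda>_. c)"
  by (rule smooth_coinduct[of _ "range (\<lambda>c _. c)"]) auto

lemma iter_partial_add:
  assumes "smooth \<phi>" "smooth \<psi>" "set bs \<subseteq> Basis"
  shows "iter_partial bs (\<lambda>x. \<phi> x + \<psi> x) = (\<lambda>x. iter_partial bs \<phi> x + iter_partial bs \<psi> x)"
  using assms(3)
  by (induction bs)
    (auto simp: assms frechet_derivative_add smooth_differentiable smooth_iter_partial)

lemma iter_partial_cmult:
  assumes "smooth \<phi>" "set bs \<subseteq> Basis"
  shows "iter_partial bs (\<lambda>x. c * \<phi> x) = (\<lambda>x. c * iter_partial bs \<phi> x)"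
  using assms(2)
  by (induction bs)
    (auto simp: assms frechet_derivative_mult smooth_differentiable smooth_iter_partial)

section \<open>Exponentials, sums and affine substitutions\<close>

abbreviation expi :: "'a::euclidean_space \<Rightarrow> 'a \<Rightarrow> complex" where
  "expi k \<equiv> (\<lambda>x. exp (- \<i> * complex_of_real (k \<bullet> x)))"

lemma has_derivative_expi:
  "(expi k has_derivative (\<lambda>h. - \<i> * complex_of_real (k \<bullet> h) * expi k x)) (at x)"
proof -
  have "(exp has_derivative (\<lambda>h. exp z * h)) (at z)" for z :: complex
    using DERIV_exp[of z] by (simp add: has_field_derivative_def)
  then show ?thesis
    by - (rule has_derivative_eq_rhs,
        rule has_derivative_compose[of "\<lambda>x. - \<i> * complex_of_real (k \<bullet> x)" _ x UNIV exp],
        auto intro!: derivative_eq_intros simp: fun_eq_iff)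
qed

lemma smooth_expi: "smooth (expi k)"
proof (rule smooth_coinduct[of _ "range (\<lambda>c x. c * expi k x)"])
  fix \<phi> :: "'a \<Rightarrow> complex" assume "\<phi> \<in> range (\<lambda>c x. c * expi k x)"
  then obtain c where \<phi>: "\<phi> = (\<lambda>x. c * expi k x)" by auto
  have d: "(\<phi> has_derivative (\<lambda>h. c * (- \<i> * complex_of_real (k \<bullet> h) * expi k x))) (at x)" for x
    unfolding \<phi> by (intro has_derivative_mult_right has_derivative_expi)
  show "\<phi> differentiable (at x)" for x using d by (auto simp: differentiable_def)
  show "(\<lambda>x. frechet_derivative \<phi> (at x) b) \<in> range (\<lambda>c x. c * expi k x)" for b
    by (rule range_eqI[of _ _ "c * (- \<i> * complex_of_real (k \<bullet> b))"])
      (simp add: frechet_derivative_eqI[OF d] mult.assoc)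
qed (auto intro: range_eqI[of _ _ 1])

lemma smooth_sum: "(\<And>i. i \<in> I \<Longrightarrow> smooth (\<phi> i)) \<Longrightarrow> smooth (\<lambda>x. \<Sum>i\<in>I. \<phi> i x)"
  by (induction I rule: infinite_finite_induct) (auto intro: smooth_const smooth_add)

lemma smooth_compose_affine:
  fixes \<phi> :: "'b::euclidean_space \<Rightarrow> complex" and L :: "'a::euclidean_space \<Rightarrow> 'b"
  assumes "smooth \<phi>" "linear L"
  shows "smooth (\<lambda>x. \<phi> (L x + c))"
proof (rule smooth_coinduct[of _ "{\<lambda>x. \<psi> (L x + c) | \<psi>. smooth \<psi>}"])
  fix \<eta> :: "'a \<Rightarrow> complex"
  assume "\<eta> \<in> {\<lambda>x. \<psi> (L x + c) | \<psi>. smooth \<psi>}"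
  then obtain \<psi> where \<psi>: "smooth \<psi>" and \<eta>: "\<eta> = (\<lambda>x. \<psi> (L x + c))" by auto
  have d: "(\<eta> has_derivative (\<lambda>h. frechet_derivative \<psi> (at (L x + c)) (L h))) (at x)" for x
    unfolding \<eta>
    by (rule has_derivative_compose[of "\<lambda>x. L x + c" L x UNIV \<psi>])
      (auto intro!: derivative_eq_intros smooth_has_derivative \<psi> linear_imp_has_derivative assms)
  show "\<eta> differentiable (at x)" for x using d by (auto simp: differentiable_def)
  fix b :: 'a assume "b \<in> Basis"
  \<comment> \<open>The chain rule gives the derivative of \<open>\<psi>\<close> in the direction
    \<open>L b\<close>, which need not be a basis vector. \<open>\<theta>\<close> expands it into
    partials of \<open>\<psi>\<close>, so the family is closed.\<close>
  define \<theta> where "\<theta> = (\<lambda>y. \<Sum>i\<in>Basis. complex_of_real (L b \<bullet> i) * frechet_derivative \<psi> (at y) i)"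
  have "frechet_derivative \<psi> (at y) (L b) = \<theta> y" for y
  proof -
    have lin: "linear (frechet_derivative \<psi> (at y))"
      using \<psi> smooth_differentiable linear_frechet_derivative by blast
    have "frechet_derivative \<psi> (at y) (L b)
        = frechet_derivative \<psi> (at y) (\<Sum>i\<in>Basis. (L b \<bullet> i) *\<^sub>R i)"
      by (simp add: euclidean_representation)
    then show ?thesis
      by (simp add: \<theta>_def linear_sum[OF lin] linear_scale[OF lin] scaleR_conv_of_real)
  qed
  moreover have "smooth \<theta>"
    unfolding \<theta>_def by (intro smooth_sum smooth_mult smooth_const smooth_partial \<psi>)
  ultimately show "(\<lambda>x. frechet_derivative \<eta> (at x) b) \<in> {\<lambda>x. \<psi> (L x + c) | \<psi>. smooth \<psi>}"
    using frechet_derivative_eqI[OF d] by auto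
qed (use assms in auto)

section \<open>Supports and closure properties of test functions\<close>

lemma supp_subset: "(\<And>x. x \<notin> K \<Longrightarrow> \<phi> x = 0) \<Longrightarrow> closed K \<Longrightarrow> supp \<phi> \<subseteq> K"
  unfolding supp_def by (rule closure_minimal) auto

lemma zero_outside_supp: "x \<notin> supp \<phi> \<Longrightarrow> \<phi> x = 0"
  using closure_subset[of "{x. \<phi> x \<noteq> 0}"] by (auto simp: supp_def)

lemma test_functionI:
  assumes "smooth \<phi>" "compact K" "\<And>x. x \<notin> K \<Longrightarrow> \<phi> x = 0"
  shows "\<phi> \<in> test_functions UNIV"
proof -
  have "supp \<phi> \<subseteq> K" using assms by (intro supp_subset) (auto simp: compact_imp_closed)
  then have "compact (supp \<phi>)"
    using compact_Int_closed[OF assms(2), of "supp \<phi>"] by (simp add: supp_def Int_absorb1)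
  then show ?thesis using assms by (simp add: test_functions_def)
qed

lemma test_function_smooth: "\<phi> \<in> test_functions \<Omega> \<Longrightarrow> smooth \<phi>"
  and test_function_compact: "\<phi> \<in> test_functions \<Omega> \<Longrightarrow> compact (supp \<phi>)"
  by (auto simp: test_functions_def)

lemma test_function_add:
  assumes "\<phi> \<in> test_functions UNIV" "\<psi> \<in> test_functions UNIV"
  shows "(\<lambda>x. \<phi> x + \<psi> x) \<in> test_functions UNIV"
  by (rule test_functionI[of _ "supp \<phi> \<union> supp \<psi>"])
    (use assms in \<open>auto simp: test_functions_def zero_outside_supp[of _ \<phi>]
      zero_outside_supp[of _ \<psi>] intro: smooth_add\<close>)

lemma test_function_mult:
  assumes "\<phi> \<in> test_functions UNIV" "smooth \<psi>"
  shows "(\<lambda>x. \<phi> x * \<psi> x) \<in> test_functions UNIV"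
  by (rule test_functionI[of _ "supp \<phi>"])
    (use assms in \<open>auto simp: test_functions_def zero_outside_supp[of _ \<phi>] intro: smooth_mult\<close>)

lemma test_function_cmult:
  assumes "\<phi> \<in> test_functions UNIV"
  shows "(\<lambda>x. c * \<phi> x) \<in> test_functions UNIV"
  using test_function_mult[OF assms smooth_const[of c]] by (simp add: mult.commute)

lemma supp_partial_subset: "supp (\<lambda>x. frechet_derivative \<phi> (at x) b) \<subseteq> supp \<phi>"
proof (rule supp_subset)
  fix x assume x: "x \<notin> supp \<phi>"
  have "(\<phi> has_derivative (\<lambda>_. 0)) (at x)"
    by (rule has_derivative_transform_within_open[of "\<lambda>_. 0" _ x UNIV "- supp \<phi>"])
      (use x in \<open>auto simp: supp_def open_Compl dest: zero_outside_supp[of _ \<phi>, unfolded supp_def]\<close>)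
  then show "frechet_derivative \<phi> (at x) b = 0"
    by (simp add: frechet_derivative_eqI)
qed (simp add: supp_def)

lemma supp_iter_partial_subset: "supp (iter_partial bs \<phi>) \<subseteq> supp \<phi>"
  using supp_partial_subset by (induction bs) fastforce+

lemma test_function_iter_partial:
  assumes "\<phi> \<in> test_functions UNIV" "set bs \<subseteq> Basis"
  shows "iter_partial bs \<phi> \<in> test_functions UNIV"
  using assms supp_iter_partial_subset[of bs \<phi>]
  by (intro test_functionI[of _ "supp \<phi>"])
    (auto simp: test_functions_def intro: smooth_iter_partial zero_outside_supp)

lemma test_function_partial:
  assumes "\<phi> \<in> test_functions UNIV" "b \<in> Basis"
  shows "(\<lambda>x. frechet_derivative \<phi> (at x) b) \<in> test_functions UNIV"
  using test_function_iter_partial[of \<phi> "[b]"] assms by simp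

text \<open>The estimates in \<open>distributions\<close> use suprema of reals, which are meaningful
  only for sets that are bounded above.\<close>

lemma test_function_bdd_above:
  assumes "\<phi> \<in> test_functions UNIV"
  shows "bdd_above (range (\<lambda>x. cmod (\<phi> x)))"
proof -
  have "compact (\<phi> ` supp \<phi>)"
    using assms by (intro compact_continuous_image)
      (auto simp: test_functions_def intro: smooth_continuous_on)
  then obtain B where "\<And>x. x \<in> supp \<phi> \<Longrightarrow> cmod (\<phi> x) \<le> B"
    by (metis bounded_iff compact_imp_bounded imageI)
  then have "cmod (\<phi> x) \<le> max B 0" for x
    by (cases "x \<in> supp \<phi>") (auto simp: zero_outside_supp[of _ \<phi>] intro: max.coboundedI1)
  then show ?thesis by (intro bdd_aboveI2)
qed

lemma smooth_real_has_vector_derivative: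
  fixes \<phi> :: "real \<Rightarrow> complex"
  assumes "smooth \<phi>"
  shows "(\<phi> has_vector_derivative frechet_derivative \<phi> (at x) 1) (at x)"
proof -
  have "frechet_derivative \<phi> (at x) h = h *\<^sub>R frechet_derivative \<phi> (at x) 1" for h :: real
    using linear_scale[OF linear_frechet_derivative[OF smooth_differentiable[OF assms]], of x h 1]
    by simp
  then show ?thesis
    unfolding has_vector_derivative_def
    by - (rule has_derivative_eq_rhs[OF smooth_has_derivative[OF assms]], rule ext)
qed

section \<open>A bump function\<close>

text \<open>The classical flat function \<open>exp (- (1 / t))\<close> with a polynomial factor in
  \<open>1 / t\<close>. The factor makes the family closed under differentiation.\<close>

definition flat :: "real poly \<Rightarrow> real \<Rightarrow> real" where
  "flat p t = (if 0 < t then poly p (1 / t) * exp (- (1 / t)) else 0)"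

lemma poly_times_exp_tendsto_0: "((\<lambda>s::real. poly p s * exp (- s)) \<longlongrightarrow> 0) at_top"
proof -
  have "((\<lambda>s. \<Sum>i\<le>degree p. coeff p i * (s ^ i / exp s)) \<longlongrightarrow> 0) at_top"
    by (intro tendsto_null_sum tendsto_mult_right_zero tendsto_power_div_exp_0)
  then show ?thesis
    by (simp add: poly_altdef sum_distrib_right sum_divide_distrib exp_minus divide_inverse mult.assoc)
qed

lemma isCont_flat_0: "isCont (flat p) 0"
proof -
  have "(flat p \<longlongrightarrow> 0) (at_right 0)"
  proof (rule Lim_transform_eventually)
    show "((\<lambda>t. poly p (inverse t) * exp (- inverse t)) \<longlongrightarrow> 0) (at_right 0)"
      by (rule filterlim_compose[OF poly_times_exp_tendsto_0 filterlim_inverse_at_top_right])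
    show "\<forall>\<^sub>F t in at_right 0. poly p (inverse t) * exp (- inverse t) = flat p t"
      by (auto simp: eventually_at_filter flat_def inverse_eq_divide)
  qed
  moreover have "(flat p \<longlongrightarrow> 0) (at_left 0)"
    by (rule tendsto_eventually) (auto simp: eventually_at_filter flat_def)
  ultimately show ?thesis
    by (simp add: isCont_def filterlim_split_at flat_def)
qed

text \<open>For t > 0 put s = 1/t, so that ds/dt = -s^2. Then p(s) exp(-s) has the derivative s^2
  (p(s) - p'(s)) exp(-s), which lies in the family again.\<close>

lemma flat_has_derivative:
  "(flat p has_real_derivative flat (monom 1 2 * (p - pderiv p)) t) (at t)"
proof -
  consider "t < 0" | "t = 0" | "t > 0" by linarith
  then show ?thesis
  proof cases
    assume "t < 0"
    then show ?thesis
      by - (rule has_field_derivative_transform_within_open[of "\<lambda>_. 0" _ t "{..<0}"],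
        auto simp: flat_def)
  next
    assume "t = 0"
    \<comment> \<open>Caratheodory's criterion: \<open>flat p t = t * flat (pCons 0 p) t\<close>, so
      the difference quotient at 0 extends to \<open>flat (pCons 0 p)\<close>, which is continuous
      with value 0 there.\<close>
    moreover have "(flat p has_real_derivative 0) (at 0)"
      unfolding CARAT_DERIV
      by (intro exI[of _ "flat (pCons 0 p)"] conjI isCont_flat_0) (auto simp: flat_def)
    ultimately show ?thesis by (simp add: flat_def)
  next
    assume t: "t > 0"
    have "((\<lambda>t. poly p (1 / t) * exp (- (1 / t))) has_real_derivative
        flat (monom 1 2 * (p - pderiv p)) t) (at t)"
      using t by (auto intro!: derivative_eq_intros
          simp: flat_def poly_monom field_simps power2_eq_square)
    then show ?thesis
      by (rule has_field_derivative_transform_within_open[of _ _ t "{0<..}"])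
        (use t in \<open>auto simp: flat_def\<close>)
  qed
qed

lemma smooth_flat: "smooth (\<lambda>t. complex_of_real (flat p t))"
proof (rule smooth_coinduct[of _ "range (\<lambda>p t. complex_of_real (flat p t))"])
  fix \<phi> assume "\<phi> \<in> range (\<lambda>p t. complex_of_real (flat p t))"
  then obtain p where \<phi>: "\<phi> = (\<lambda>t. complex_of_real (flat p t))" by auto
  have d: "(\<phi> has_derivative (\<lambda>h. complex_of_real (flat (monom 1 2 * (p - pderiv p)) t * h))) (at t)" for t
    unfolding \<phi> using flat_has_derivative
    by (intro has_derivative_of_real) (simp add: has_field_derivative_def)
  show "\<phi> differentiable (at t)" for t using d by (auto simp: differentiable_def)
  show "(\<lambda>t. frechet_derivative \<phi> (at t) b) \<in> range (\<lambda>p t. complex_of_real (flat p t))"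
    if "b \<in> Basis" for b
    using that by (auto simp: frechet_derivative_eqI[OF d])
qed auto

text \<open>Positive exactly on the open interval of radius 1 about \<open>c\<close>. The arguments
  are written as linear part plus constant, the shape that \<open>smooth_compose_affine\<close>
  expects.\<close>

definition bump :: "real \<Rightarrow> real \<Rightarrow> real" where
  "bump c t = flat 1 (t + (1 - c)) * flat 1 (- t + (1 + c))"

lemma bump_nonneg: "0 \<le> bump c t"
  by (simp add: bump_def flat_def)

lemma bump_pos: "\<bar>t - c\<bar> < 1 \<Longrightarrow> 0 < bump c t"
  by (auto simp: bump_def flat_def)

lemma bump_eq_0: "1 \<le> \<bar>t - c\<bar> \<Longrightarrow> bump c t = 0"
  by (auto simp: bump_def flat_def)

lemma test_function_bump: "(\<lambda>t. complex_of_real (bump c t)) \<in> test_functions UNIV"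
proof (rule test_functionI[of _ "{c - 1..c + 1}"])
  have "linear (\<lambda>t::real. t)" "linear (\<lambda>t::real. - t)"
    by (auto intro: linearI)
  then show "smooth (\<lambda>t. complex_of_real (bump c t))"
    unfolding bump_def of_real_mult
    by (intro smooth_mult smooth_compose_affine[of "\<lambda>t. complex_of_real (flat 1 t)"] smooth_flat)
qed (auto intro: bump_eq_0)

section \<open>Integrals of test functions\<close>

lemma integrable_test_function:
  assumes "\<phi> \<in> test_functions UNIV"
  shows "integrable lborel \<phi>"
proof -
  have "integrable lborel (\<lambda>x. indicator (supp \<phi>) x *\<^sub>R \<phi> x)"
    using assms by (intro borel_integrable_compact)
      (auto simp: test_functions_def smooth_continuous_on)
  moreover have "(\<lambda>x. indicator (supp \<phi>) x *\<^sub>R \<phi> x) = \<phi>"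
    by (auto simp: indicator_def zero_outside_supp[of _ \<phi>])
  ultimately show ?thesis by simp
qed

lemma lborel_integral_eq_cbox:
  assumes "\<phi> \<in> test_functions UNIV" "\<And>x. x \<notin> cbox a b \<Longrightarrow> \<phi> x = 0"
  shows "(LINT x|lborel. \<phi> x) = integral (cbox a b) \<phi>"
proof -
  have "(LINT x|lborel. \<phi> x) = integral UNIV \<phi>"
    by (rule integral_lborel[OF integrable_test_function[OF assms(1)], symmetric])
  also have "\<dots> = integral UNIV (\<lambda>x. if x \<in> cbox a b then \<phi> x else 0)"
    by (rule integral_cong) (auto simp: assms(2))
  finally show ?thesis by (simp add: integral_restrict_UNIV)
qed

lemma test_function_support_radius:
  assumes "\<phi> \<in> test_functions UNIV"
  shows "\<exists>R>0. \<forall>x. R \<le> norm x \<longrightarrow> \<phi> x = 0"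
proof -
  obtain R where R: "0 < R" "\<And>x. x \<in> supp \<phi> \<Longrightarrow> norm x < R"
    using compact_imp_bounded[OF test_function_compact[OF assms]]
    by (auto simp: bounded_pos_less)
  then have "\<phi> x = 0" if "R \<le> norm x" for x
    using that by (intro zero_outside_supp) force
  then show ?thesis using R(1) by blast
qed

text \<open>The fundamental theorem of calculus, on an interval so large that the boundary terms
  vanish. This is what later permits integration by parts.\<close>

lemma lborel_integral_derivative_test_function:
  fixes \<phi> :: "real \<Rightarrow> complex"
  assumes "\<phi> \<in> test_functions UNIV"
  shows "(LINT x|lborel. frechet_derivative \<phi> (at x) 1) = 0"
proof -
  have d: "(\<lambda>x. frechet_derivative \<phi> (at x) 1) \<in> test_functions UNIV"
    using assms by (intro test_function_partial) auto
  obtain R where R: "0 < R" "\<forall>x. R \<le> norm x \<longrightarrow> \<phi> x = 0"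
    using test_function_support_radius[OF assms] by (elim exE conjE)
  obtain R' where R': "0 < R'" "\<forall>x. R' \<le> norm x \<longrightarrow> frechet_derivative \<phi> (at x) 1 = 0"
    using test_function_support_radius[OF d] by (elim exE conjE)
  \<comment> \<open>\<open>R\<close> makes the boundary terms vanish, and \<open>R'\<close> reduces
    the integral over the line to one over \<open>{- T..T}\<close>.\<close>
  define T where "T = max R R'"
  have "((\<lambda>x. frechet_derivative \<phi> (at x) 1) has_integral \<phi> T - \<phi> (- T)) {- T..T}"
  proof (rule fundamental_theorem_of_calculus)
    show "- T \<le> T" using R(1) by (simp add: T_def)
    show "(\<phi> has_vector_derivative frechet_derivative \<phi> (at x) 1) (at x within {- T..T})" for x
      by (rule has_vector_derivative_at_within[OF smooth_real_has_vector_derivative])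
        (rule test_function_smooth[OF assms])
  qed
  moreover have "\<phi> T = 0" "\<phi> (- T) = 0"
    using R by (auto simp: T_def)
  moreover have "frechet_derivative \<phi> (at x) 1 = 0" if "x \<notin> cbox (- T) T" for x
    using that R'(2) by (auto simp: T_def not_le)
  ultimately show ?thesis
    using lborel_integral_eq_cbox[OF d, of "- T" T] by (simp add: integral_unique)
qed

section \<open>Integration along the fibres of the projection\<close>

lemma test_function_fiber:
  fixes \<phi> :: "'a::euclidean_space \<times> 'b::euclidean_space \<Rightarrow> complex"
  assumes "\<phi> \<in> test_functions UNIV"
  shows "(\<lambda>y. \<phi> (x, y)) \<in> test_functions UNIV"
proof (rule test_functionI[of _ "snd ` supp \<phi>"])
  have "smooth (\<lambda>y. \<phi> ((0, y) + (x, 0)))"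
    using test_function_smooth[OF assms]
    by (rule smooth_compose_affine) (auto intro: linearI)
  then show "smooth (\<lambda>y. \<phi> (x, y))" by simp
  show "compact (snd ` supp \<phi>)"
    using test_function_compact[OF assms] by (intro compact_continuous_image continuous_intros)
  show "\<phi> (x, y) = 0" if "y \<notin> snd ` supp \<phi>" for y
    using that zero_outside_supp[of "(x, y)" \<phi>] by force
qed

text \<open>The push-forward along \<open>fst\<close>, whose transpose is the pull-back.\<close>

definition fiber_integral ::
    "('a::euclidean_space \<times> 'b::euclidean_space \<Rightarrow> complex) \<Rightarrow> 'a \<Rightarrow> complex" where
  "fiber_integral \<phi> x = (LINT y|lborel. \<phi> (x, y))"

lemma fiber_integral_has_derivative:
  fixes \<phi> :: "real \<times> real \<Rightarrow> complex"
  assumes \<phi>: "\<phi> \<in> test_functions UNIV"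
  shows "(fiber_integral \<phi> has_vector_derivative
    fiber_integral (\<lambda>p. frechet_derivative \<phi> (at p) (1, 0)) x) (at x)"
proof -
  define \<phi>' where "\<phi>' = (\<lambda>p. frechet_derivative \<phi> (at p) (1, 0))"
  have \<phi>': "\<phi>' \<in> test_functions UNIV"
    unfolding \<phi>'_def using \<phi> by (intro test_function_partial) (auto simp: Basis_prod_def)
  obtain R where R: "0 < R" "\<forall>p. R \<le> norm p \<longrightarrow> \<phi> p = 0"
    using test_function_support_radius[OF \<phi>] by (elim exE conjE)
  obtain R' where R': "0 < R'" "\<forall>p. R' \<le> norm p \<longrightarrow> \<phi>' p = 0"
    using test_function_support_radius[OF \<phi>'] by (elim exE conjE)
  \<comment> \<open>Outside one interval all fibres of \<open>\<phi>\<close> and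
    \<open>\<phi>'\<close> vanish, uniformly in \<open>x\<close>. The Leibniz rule needs such a
    fixed domain of integration.\<close>
  define T where "T = max R R'"
  have T: "max R R' \<le> norm (x, y)" if "y \<notin> cbox (- T) T" for x y :: real
    using that norm_snd_le[of y x] by (auto simp: T_def)
  have eq: "fiber_integral \<phi> = (\<lambda>x. integral (cbox (- T) T) (\<lambda>y. \<phi> (x, y)))"
    unfolding fiber_integral_def using R T
    by (intro ext lborel_integral_eq_cbox test_function_fiber \<phi>) auto
  have eq': "fiber_integral \<phi>' x = integral (cbox (- T) T) (\<lambda>y. \<phi>' (x, y))"
    unfolding fiber_integral_def using R' T
    by (intro lborel_integral_eq_cbox test_function_fiber \<phi>') auto
  have "((\<lambda>x. integral (cbox (- T) T) (\<lambda>y. \<phi> (x, y))) has_vector_derivative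
      integral (cbox (- T) T) (\<lambda>y. \<phi>' (x, y))) (at x within UNIV)"
  proof (rule leibniz_rule_vector_derivative[where U = UNIV and f = "\<lambda>x y. \<phi> (x, y)"
        and fx = "\<lambda>x y. \<phi>' (x, y)"])
    fix x y :: real
    have "((\<lambda>x. \<phi> (x, y)) has_derivative (\<lambda>h. frechet_derivative \<phi> (at (x, y)) (h, 0))) (at x)"
      by (rule has_derivative_compose[of "\<lambda>x. (x, y)" _ x UNIV \<phi>])
        (auto intro!: derivative_eq_intros smooth_has_derivative test_function_smooth[OF \<phi>])
    moreover have "frechet_derivative \<phi> (at (x, y)) (h, 0) = h *\<^sub>R \<phi>' (x, y)" for h
      using linear_scale[OF linear_frechet_derivative[OF smooth_differentiable[OF test_function_smooth[OF \<phi>]]],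
          of "(x, y)" h "(1, 0)"] by (simp add: \<phi>'_def)
    ultimately show "((\<lambda>x. \<phi> (x, y)) has_vector_derivative \<phi>' (x, y)) (at x within UNIV)"
      by (simp add: has_vector_derivative_def)
  next
    show "(\<lambda>y. \<phi> (x, y)) integrable_on cbox (- T) T" for x
      by (intro integrable_continuous smooth_continuous_on test_function_smooth[OF test_function_fiber[OF \<phi>]])
    show "continuous_on (UNIV \<times> cbox (- T) T) (\<lambda>(x, y). \<phi>' (x, y))"
      using smooth_continuous_on[OF test_function_smooth[OF \<phi>']] by simp
  qed auto
  then show ?thesis unfolding \<phi>'_def[symmetric] eq eq' by simp
qed

lemma frechet_derivative_fiber_integral:
  fixes \<phi> :: "real \<times> real \<Rightarrow> complex"
  assumes \<phi>: "\<phi> \<in> test_functions UNIV"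
  shows "(\<lambda>x. frechet_derivative (fiber_integral \<phi>) (at x) 1)
    = fiber_integral (\<lambda>p. frechet_derivative \<phi> (at p) (1, 0))"
  by (rule ext, subst frechet_derivative_eqI[OF
        fiber_integral_has_derivative[OF \<phi>, unfolded has_vector_derivative_def]]) simp

text \<open>Differentiation under the integral turns the derivative of a fibre integral into the
  fibre integral of a partial, so the fibre integrals of all test functions form a family to which
  \<open>smooth_coinduct\<close> applies.\<close>

lemma test_function_fiber_integral:
  fixes \<phi> :: "real \<times> real \<Rightarrow> complex"
  assumes \<phi>: "\<phi> \<in> test_functions UNIV"
  shows "fiber_integral \<phi> \<in> test_functions UNIV"
proof (rule test_functionI[of _ "fst ` supp \<phi>"])
  show "smooth (fiber_integral \<phi>)"
  proof (rule smooth_coinduct[of _ "fiber_integral ` test_functions UNIV"])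
    fix \<psi> :: "real \<Rightarrow> complex"
    assume "\<psi> \<in> fiber_integral ` (test_functions UNIV :: (real \<times> real \<Rightarrow> complex) set)"
    then obtain \<phi> :: "real \<times> real \<Rightarrow> complex"
      where \<phi>: "\<phi> \<in> test_functions UNIV" and \<psi>: "\<psi> = fiber_integral \<phi>" by auto
    show "\<psi> differentiable (at x)" for x
      unfolding \<psi> using fiber_integral_has_derivative[OF \<phi>]
      by (auto simp: has_vector_derivative_def differentiable_def)
    show "(\<lambda>x. frechet_derivative \<psi> (at x) b) \<in> fiber_integral ` (test_functions UNIV :: (real \<times> real \<Rightarrow> complex) set)"
      if "b \<in> Basis" for b
      using that by (auto simp: \<psi> frechet_derivative_fiber_integral[OF \<phi>] Basis_prod_def
          intro!: imageI test_function_partial \<phi>)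
  qed (use \<phi> in auto)
  show "compact (fst ` supp \<phi>)"
    using test_function_compact[OF \<phi>] by (intro compact_continuous_image continuous_intros)
  fix x assume "x \<notin> fst ` supp \<phi>"
  then have "\<phi> (x, y) = 0" for y using zero_outside_supp[of "(x, y)" \<phi>] by force
  then show "fiber_integral \<phi> x = 0" by (simp add: fiber_integral_def)
qed

section \<open>Fourier decay and growth\<close>

lemma norm_expi: "cmod (expi k x) = 1"
  by (simp add: norm_exp_eq_Re)

text \<open>A derivative that falls on the exponential costs one factor
  \<open>k \<bullet> b\<close>. Integrated, this yields the decay of Fourier transforms; estimated,
  it yields the polynomial growth of distributions on modulated test functions.\<close>

lemma frechet_derivative_modulate:
  assumes "smooth \<phi>"
  shows "(\<lambda>x. frechet_derivative (\<lambda>x. \<phi> x * expi k x) (at x) b)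
    = (\<lambda>x. frechet_derivative \<phi> (at x) b * expi k x
        + - \<i> * complex_of_real (k \<bullet> b) * (\<phi> x * expi k x))"
proof
  fix x
  have "frechet_derivative (expi k) (at x) b = - \<i> * complex_of_real (k \<bullet> b) * expi k x"
    using frechet_derivative_eqI[OF has_derivative_expi[of k x]] by (simp add: fun_eq_iff)
  then show "frechet_derivative (\<lambda>x. \<phi> x * expi k x) (at x) b
      = frechet_derivative \<phi> (at x) b * expi k x
        + - \<i> * complex_of_real (k \<bullet> b) * (\<phi> x * expi k x)"
    by (subst frechet_derivative_mult)
      (simp_all only: smooth_differentiable assms smooth_expi, simp add: algebra_simps)
qed

definition fourier_integral :: "(real \<Rightarrow> complex) \<Rightarrow> real \<Rightarrow> complex" where
  "fourier_integral \<phi> k = (LINT x|lborel. \<phi> x * expi k x)"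

text \<open>Integration by parts: the derivative of the modulated function has integral zero, and
  its two product rule terms are the two sides.\<close>

lemma fourier_integral_derivative:
  assumes \<phi>: "\<phi> \<in> test_functions UNIV"
  shows "fourier_integral (\<lambda>x. frechet_derivative \<phi> (at x) 1) k
    = \<i> * complex_of_real k * fourier_integral \<phi> k"
proof -
  have d: "(\<lambda>x. frechet_derivative \<phi> (at x) 1) \<in> test_functions UNIV"
    using \<phi> by (intro test_function_partial) auto
  have i: "integrable lborel (\<lambda>x. frechet_derivative \<phi> (at x) 1 * expi k x)"
      "integrable lborel (\<lambda>x. \<phi> x * expi k x)"
    by (intro integrable_test_function test_function_mult \<phi> d smooth_expi)+
  have "0 = (LINT x|lborel. frechet_derivative (\<lambda>x. \<phi> x * expi k x) (at x) 1)"
    by (intro lborel_integral_derivative_test_function[symmetric] test_function_mult \<phi> smooth_expi)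
  also have "\<dots> = (LINT x|lborel. frechet_derivative \<phi> (at x) 1 * expi k x
      + - \<i> * complex_of_real (k \<bullet> 1) * (\<phi> x * expi k x))"
    by (simp only: frechet_derivative_modulate[OF test_function_smooth[OF \<phi>]])
  also have "\<dots> = fourier_integral (\<lambda>x. frechet_derivative \<phi> (at x) 1) k
      + - \<i> * complex_of_real (k \<bullet> 1) * fourier_integral \<phi> k"
    unfolding fourier_integral_def
    by (subst Bochner_Integration.integral_add[OF i(1) integrable_mult_right[OF i(2)]])
      (subst integral_mult_right_zero, rule refl)
  finally show ?thesis by (simp add: algebra_simps)
qed

lemma fourier_integral_rapid_decay:
  assumes "\<phi> \<in> test_functions UNIV"
  shows "\<exists>C. \<forall>k. (1 + \<bar>k\<bar>) ^ N * cmod (fourier_integral \<phi> k) \<le> C"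
  using assms
proof (induction N arbitrary: \<phi>)
  case 0
  have "cmod (fourier_integral \<phi> k) \<le> (LINT x|lborel. cmod (\<phi> x))" for k
    unfolding fourier_integral_def
    by (rule order_trans[OF integral_norm_bound]) (simp add: norm_mult norm_expi del: inner_real_def)
  then show ?case by auto
next
  case (Suc N)
  obtain C where C: "\<And>k. (1 + \<bar>k\<bar>) ^ N * cmod (fourier_integral \<phi> k) \<le> C"
    using Suc by blast
  obtain C' where C': "\<And>k. (1 + \<bar>k\<bar>) ^ N
      * cmod (fourier_integral (\<lambda>x. frechet_derivative \<phi> (at x) 1) k) \<le> C'"
    using Suc.IH[OF test_function_partial[OF Suc.prems]] by force
  \<comment> \<open>Of the new factor \<open>1 + \<bar>k\<bar>\<close>, the summand 1 is covered by
    \<open>C\<close> and the summand \<open>\<bar>k\<bar>\<close> by \<open>C'\<close>, as the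
    transform of the derivative has \<open>\<bar>k\<bar>\<close> times the modulus of that of
    \<open>\<phi>\<close>.\<close>
  have "(1 + \<bar>k\<bar>) ^ Suc N * cmod (fourier_integral \<phi> k) \<le> C + C'" for k
    using C[of k] C'[of k]
    by (simp add: fourier_integral_derivative[OF Suc.prems] norm_mult algebra_simps)
  then show ?case by blast
qed

text \<open>The induction removes the last list entry because that partial is applied first: one
  product rule then leaves two modulated test functions with a shorter list, at the cost of a factor
  \<open>norm k\<close> on one of them.\<close>

lemma iter_partial_modulate_bound:
  fixes \<phi> :: "'a::euclidean_space \<Rightarrow> complex"
  assumes "\<phi> \<in> test_functions UNIV" "set bs \<subseteq> Basis"
  shows "\<exists>C\<ge>0. \<forall>k x. cmod (iter_partial bs (\<lambda>x. \<phi> x * expi k x) x) \<le> C * (1 + norm k) ^ length bs"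
  using assms
proof (induction bs arbitrary: \<phi> rule: rev_induct)
  case Nil
  obtain B where "\<And>x. cmod (\<phi> x) \<le> B"
    using test_function_bdd_above[OF Nil(1)] by (auto simp: bdd_above_def)
  then have "0 \<le> B" "cmod (\<phi> x * expi k x) \<le> B" for k x
    using norm_ge_zero order_trans by (blast, simp only: norm_mult norm_expi mult_1_right)
  then show ?case by auto
next
  case (snoc b bs)
  note \<phi> = snoc.prems(1)
  have b: "b \<in> Basis" and bs: "set bs \<subseteq> Basis" using snoc.prems by auto
  have d: "(\<lambda>x. frechet_derivative \<phi> (at x) b) \<in> test_functions UNIV"
    using \<phi> b by (rule test_function_partial)
  obtain C where C: "C \<ge> 0"
      "\<And>k x. cmod (iter_partial bs (\<lambda>x. \<phi> x * expi k x) x) \<le> C * (1 + norm k) ^ length bs"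
    using snoc.IH[OF \<phi> bs] by blast
  obtain C' where C': "C' \<ge> 0" "\<And>k x. cmod (iter_partial bs
      (\<lambda>x. frechet_derivative \<phi> (at x) b * expi k x) x) \<le> C' * (1 + norm k) ^ length bs"
    using snoc.IH[OF d bs] by blast
  have "cmod (iter_partial (bs @ [b]) (\<lambda>x. \<phi> x * expi k x) x)
      \<le> (C + C') * (1 + norm k) ^ length (bs @ [b])" for k x
  proof -
    have "iter_partial (bs @ [b]) (\<lambda>x. \<phi> x * expi k x) x
      = iter_partial bs (\<lambda>x. frechet_derivative \<phi> (at x) b * expi k x) x
        + - \<i> * complex_of_real (k \<bullet> b) * iter_partial bs (\<lambda>x. \<phi> x * expi k x) x"
      unfolding iter_partial_append iter_partial.simps
      by (subst frechet_derivative_modulate, rule test_function_smooth[OF \<phi>],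
        subst iter_partial_add, rule smooth_mult[OF test_function_smooth[OF d] smooth_expi],
        intro smooth_mult smooth_const smooth_expi test_function_smooth[OF \<phi>], rule bs,
        subst iter_partial_cmult,
        intro smooth_mult smooth_expi test_function_smooth[OF \<phi>], rule bs, rule refl)
    also have "cmod \<dots> \<le> C' * (1 + norm k) ^ length bs + norm k * (C * (1 + norm k) ^ length bs)"
    proof (rule norm_triangle_le[OF add_mono[OF C'(2)]])
      have "\<bar>k \<bullet> b\<bar> \<le> norm k" using b Basis_le_norm by blast
      then show "cmod (- \<i> * complex_of_real (k \<bullet> b) * iter_partial bs (\<lambda>x. \<phi> x * expi k x) x)
          \<le> norm k * (C * (1 + norm k) ^ length bs)"
        unfolding norm_mult by (intro mult_mono C) auto
    qed
    also have "\<dots> \<le> (C + C') * (1 + norm k) ^ length (bs @ [b])"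
      using C(1) C'(1) by (simp add: algebra_simps)
    finally show ?thesis .
  qed
  then show ?case using C(1) C'(1) by (intro exI[of _ "C + C'"]) simp
qed

section \<open>Estimates for distributions\<close>

lemma distributions_add:
  "u \<in> distributions \<Omega> \<Longrightarrow> \<phi> \<in> test_functions \<Omega> \<Longrightarrow> \<psi> \<in> test_functions \<Omega> \<Longrightarrow>
    u (\<lambda>x. \<phi> x + \<psi> x) = u \<phi> + u \<psi>"
  and distributions_cmult:
  "u \<in> distributions \<Omega> \<Longrightarrow> \<phi> \<in> test_functions \<Omega> \<Longrightarrow> u (\<lambda>x. c * \<phi> x) = c * u \<phi>"
  by (simp_all add: distributions_def)

lemma cmod_le_SUP:
  assumes "\<phi> \<in> test_functions UNIV"
  shows "cmod (\<phi> x) \<le> (SUP x. cmod (\<phi> x))"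
  by (intro cSUP_upper test_function_bdd_above assms UNIV_I)

lemma SUP_iter_partial_nonneg:
  assumes "\<phi> \<in> test_functions UNIV" "set bs \<subseteq> Basis"
  shows "0 \<le> (SUP x. cmod (iter_partial bs \<phi> x))"
  using order_trans[OF norm_ge_zero cmod_le_SUP[OF test_function_iter_partial[OF assms]]] .

lemma finite_multiindices:
  "finite {bs :: 'a::euclidean_space list. set bs \<subseteq> Basis \<and> length bs \<le> m}"
  by (rule finite_lists_length_le[OF finite_Basis])

text \<open>The constant in \<open>distributions\<close> carries no sign. Since the sum of suprema
  is nonnegative, its absolute value serves too, and inequalities can then be multiplied by
  it.\<close>

lemma distributions_bound:
  fixes u :: "'a::euclidean_space functional"
  assumes "u \<in> distributions UNIV" "compact K"
  obtains C m where "C \<ge> 0" "\<And>\<phi>. \<phi> \<in> test_functions UNIV \<Longrightarrow> supp \<phi> \<subseteq> K \<Longrightarrow>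
    cmod (u \<phi>) \<le> C * (\<Sum>bs | set bs \<subseteq> Basis \<and> length bs \<le> m. SUP x. cmod (iter_partial bs \<phi> x))"
proof -
  obtain C m where C: "\<forall>\<phi>\<in>test_functions UNIV. supp \<phi> \<subseteq> K \<longrightarrow>
    cmod (u \<phi>) \<le> C * (\<Sum>bs | set bs \<subseteq> Basis \<and> length bs \<le> m. SUP x. cmod (iter_partial bs \<phi> x))"
    using assms unfolding distributions_def by blast
  show ?thesis
  proof (rule that[of "\<bar>C\<bar>" m])
    fix \<phi> :: "'a \<Rightarrow> complex" assume \<phi>: "\<phi> \<in> test_functions UNIV" "supp \<phi> \<subseteq> K"
    have "0 \<le> (\<Sum>bs | set bs \<subseteq> Basis \<and> length bs \<le> m. SUP x. cmod (iter_partial bs \<phi> x))"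
      using \<phi>(1) by (intro sum_nonneg SUP_iter_partial_nonneg) auto
    then show "cmod (u \<phi>) \<le> \<bar>C\<bar> * (\<Sum>bs | set bs \<subseteq> Basis \<and> length bs \<le> m.
        SUP x. cmod (iter_partial bs \<phi> x))"
      using C \<phi> by (blast intro: order_trans mult_right_mono abs_ge_self)
  qed simp
qed

text \<open>Modulation does not enlarge the support, so one estimate on \<open>supp \<phi>\<close>,
  with its constant and its order \<open>m\<close>, serves for all \<open>k\<close>.\<close>

lemma distribution_modulate_bound:
  fixes u :: "'a::euclidean_space functional"
  assumes u: "u \<in> distributions UNIV" and \<phi>: "\<phi> \<in> test_functions UNIV"
  shows "\<exists>C\<ge>0. \<exists>m. \<forall>k. cmod (u (\<lambda>x. \<phi> x * expi k x)) \<le> C * (1 + norm k) ^ m"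
proof -
  obtain C m where C: "C \<ge> 0" "\<And>\<psi>. \<psi> \<in> test_functions UNIV \<Longrightarrow> supp \<psi> \<subseteq> supp \<phi> \<Longrightarrow>
      cmod (u \<psi>) \<le> C * (\<Sum>bs | set bs \<subseteq> Basis \<and> length bs \<le> m. SUP x. cmod (iter_partial bs \<psi> x))"
    using distributions_bound[OF u test_function_compact[OF \<phi>]] by blast
  define I where "I = {bs :: 'a list. set bs \<subseteq> Basis \<and> length bs \<le> m}"
  obtain D where D: "\<And>bs. bs \<in> I \<Longrightarrow> D bs \<ge> 0"
      "\<And>bs k x. bs \<in> I \<Longrightarrow> cmod (iter_partial bs (\<lambda>x. \<phi> x * expi k x) x) \<le> D bs * (1 + norm k) ^ length bs"
  proof -
    have "\<forall>bs\<in>I. \<exists>C\<ge>0. \<forall>k x. cmod (iter_partial bs (\<lambda>x. \<phi> x * expi k x) x) \<le> C * (1 + norm k) ^ length bs"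
      using iter_partial_modulate_bound[OF \<phi>] unfolding I_def by blast
    from bchoice[OF this] show ?thesis using that by blast
  qed
  have "cmod (u (\<lambda>x. \<phi> x * expi k x)) \<le> (C * sum D I) * (1 + norm k) ^ m" for k
  proof -
    have "supp (\<lambda>x. \<phi> x * expi k x) \<subseteq> supp \<phi>"
      by (rule supp_subset) (auto simp: zero_outside_supp[of _ \<phi>] compact_imp_closed[OF test_function_compact[OF \<phi>]])
    then have "cmod (u (\<lambda>x. \<phi> x * expi k x))
        \<le> C * (\<Sum>bs\<in>I. SUP x. cmod (iter_partial bs (\<lambda>x. \<phi> x * expi k x) x))"
      unfolding I_def by (intro C test_function_mult \<phi> smooth_expi)
    also have "\<dots> \<le> C * (\<Sum>bs\<in>I. D bs * (1 + norm k) ^ m)"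
    proof (intro mult_left_mono sum_mono cSUP_least C)
      fix bs x assume bs: "bs \<in> I"
      have "D bs * (1 + norm k) ^ length bs \<le> D bs * (1 + norm k) ^ m"
        using bs D(1) by (intro mult_left_mono power_increasing) (auto simp: I_def)
      then show "cmod (iter_partial bs (\<lambda>x. \<phi> x * expi k x) x) \<le> D bs * (1 + norm k) ^ m"
        using D(2)[OF bs] order_trans by blast
    qed auto
    also have "\<dots> = (C * sum D I) * (1 + norm k) ^ m"
      by (simp add: sum_distrib_right)
    finally show ?thesis .
  qed
  moreover have "C * sum D I \<ge> 0" using C(1) D(1) by (intro mult_nonneg_nonneg sum_nonneg)
  ultimately show ?thesis by blast
qed

section \<open>The pull-back and its wave front set\<close>

abbreviation (input) pullback_fst :: "real functional \<Rightarrow> (real \<times> real) functional" where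
  "pullback_fst u \<equiv> tensor_distribution UNIV UNIV u (function_distribution UNIV (\<lambda>_. 1))"

text \<open>Each fibre of \<open>\<phi>\<close> is a test function, so the inner functional takes
  its integral as value and not \<open>undefined\<close>.\<close>

lemma pullback_fst_eq:
  "\<phi> \<in> test_functions UNIV \<Longrightarrow> pullback_fst u \<phi> = u (fiber_integral \<phi>)"
  by (simp add: tensor_distribution_def function_distribution_def fiber_integral_def[abs_def]
      test_function_fiber)

lemma iter_partial_fiber_integral:
  fixes \<phi> :: "real \<times> real \<Rightarrow> complex"
  assumes "\<phi> \<in> test_functions UNIV"
  shows "iter_partial (replicate n 1) (fiber_integral \<phi>)
    = fiber_integral (iter_partial (replicate n (1, 0)) \<phi>)"
proof (induction n)
  case (Suc n)
  have "iter_partial (replicate n (1, 0)) \<phi> \<in> test_functions UNIV"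
    using assms by (intro test_function_iter_partial) (auto simp: Basis_prod_def)
  then show ?case using Suc by (simp add: frechet_derivative_fiber_integral)
qed simp

lemma fiber_integral_bound:
  fixes \<phi> :: "real \<times> real \<Rightarrow> complex"
  assumes \<phi>: "\<phi> \<in> test_functions UNIV" and R: "R \<ge> 0" "\<And>x y. R < \<bar>y\<bar> \<Longrightarrow> \<phi> (x, y) = 0"
  shows "cmod (fiber_integral \<phi> x) \<le> 2 * R * (SUP p. cmod (\<phi> p))"
proof -
  have fib: "(\<lambda>y. \<phi> (x, y)) \<in> test_functions UNIV" by (rule test_function_fiber[OF \<phi>])
  have "fiber_integral \<phi> x = integral (cbox (- R) R) (\<lambda>y. \<phi> (x, y))"
    unfolding fiber_integral_def by (rule lborel_integral_eq_cbox[OF fib]) (auto intro!: R(2))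
  moreover have "((\<lambda>y. \<phi> (x, y)) has_integral integral (cbox (- R) R) (\<lambda>y. \<phi> (x, y))) (cbox (- R) R)"
    by (intro integrable_integral integrable_continuous smooth_continuous_on test_function_smooth[OF fib])
  ultimately have "cmod (fiber_integral \<phi> x) \<le> (SUP p. cmod (\<phi> p)) * measure lborel (cbox (- R) R)"
    using cmod_le_SUP[OF \<phi>] order_trans[OF norm_ge_zero]
    by (intro has_integral_bound[where f = "\<lambda>y. \<phi> (x, y)"]) force+
  then show ?thesis using R(1) by (simp add: algebra_simps)
qed

lemma fiber_integral_add:
  assumes "\<phi> \<in> test_functions UNIV" "\<psi> \<in> test_functions UNIV"
  shows "fiber_integral (\<lambda>p. \<phi> p + \<psi> p) = (\<lambda>x. fiber_integral \<phi> x + fiber_integral \<psi> x)"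
  unfolding fiber_integral_def
  by (intro ext Bochner_Integration.integral_add integrable_test_function test_function_fiber assms)

lemma fiber_integral_cmult: "fiber_integral (\<lambda>p. c * \<phi> p) = (\<lambda>x. c * fiber_integral \<phi> x)"
  unfolding fiber_integral_def by (intro ext integral_mult_right_zero)

text \<open>Derivatives in the first variable pass under the fibre integral, and the fibres of a
  compact \<open>K\<close> lie in one bounded interval. So the estimate for \<open>u\<close> on the
  projection of \<open>K\<close> gives one of the same order on \<open>K\<close>.\<close>

lemma pullback_fst_distribution:
  assumes u: "u \<in> distributions UNIV"
  shows "pullback_fst u \<in> distributions UNIV"
proof -
  let ?u = "pullback_fst u"
  have "?u \<in> extensional (test_functions UNIV)"
    by (simp add: tensor_distribution_def)
  moreover have "?u (\<lambda>x. \<phi> x + \<psi> x) = ?u \<phi> + ?u \<psi>"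
    if "\<phi> \<in> test_functions UNIV" "\<psi> \<in> test_functions UNIV" for \<phi> \<psi>
    using that distributions_add[OF u]
    by (simp add: pullback_fst_eq test_function_add fiber_integral_add test_function_fiber_integral)
  moreover have "?u (\<lambda>x. c * \<phi> x) = c * ?u \<phi>" if "\<phi> \<in> test_functions UNIV" for c \<phi>
    using that distributions_cmult[OF u]
    by (simp add: pullback_fst_eq test_function_cmult fiber_integral_cmult test_function_fiber_integral)
  moreover have "\<exists>C m. \<forall>\<phi>\<in>test_functions UNIV. supp \<phi> \<subseteq> K \<longrightarrow>
      cmod (?u \<phi>) \<le> C * (\<Sum>bs | set bs \<subseteq> Basis \<and> length bs \<le> m. SUP x. cmod (iter_partial bs \<phi> x))"
    if K: "compact K" for K
  proof -
    have "compact (fst ` K)" using K by (intro compact_continuous_image continuous_intros)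
    then obtain C m where C: "C \<ge> 0" "\<And>\<psi>. \<psi> \<in> test_functions UNIV \<Longrightarrow> supp \<psi> \<subseteq> fst ` K \<Longrightarrow>
        cmod (u \<psi>) \<le> C * (\<Sum>bs | set bs \<subseteq> Basis \<and> length bs \<le> m. SUP x. cmod (iter_partial bs \<psi> x))"
      using distributions_bound[OF u] by blast
    obtain R where R: "R > 0" "\<And>p. p \<in> K \<Longrightarrow> norm p \<le> R"
      using compact_imp_bounded[OF K] by (auto simp: bounded_pos)
    define I where "I = {bs :: real list. set bs \<subseteq> Basis \<and> length bs \<le> m}"
    define J where "J = {bs :: (real \<times> real) list. set bs \<subseteq> Basis \<and> length bs \<le> m}"
    \<comment> \<open>\<open>2 * R\<close> is the length of the interval of integration;
      \<open>card I\<close> arises because each summand over \<open>I\<close> is bounded by the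
      whole sum over \<open>J\<close>.\<close>
    have "cmod (?u \<phi>) \<le> (C * (card I * (2 * R)))
        * (\<Sum>bs\<in>J. SUP x. cmod (iter_partial bs \<phi> x))"
      if \<phi>: "\<phi> \<in> test_functions UNIV" "supp \<phi> \<subseteq> K" for \<phi>
    proof -
      let ?S = "\<Sum>bs\<in>J. SUP x. cmod (iter_partial bs \<phi> x)"
      have "supp (fiber_integral \<phi>) \<subseteq> fst ` K"
      proof (rule supp_subset)
        fix x assume "x \<notin> fst ` K"
        then have "(x, y) \<notin> supp \<phi>" for y using \<phi>(2) by force
        then have "\<phi> (x, y) = 0" for y using zero_outside_supp[of "(x, y)" \<phi>] by blast
        then show "fiber_integral \<phi> x = 0" by (simp add: fiber_integral_def)
      qed (rule compact_imp_closed[OF \<open>compact (fst ` K)\<close>])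
      then have "cmod (?u \<phi>) \<le> C * (\<Sum>bs\<in>I. SUP x. cmod (iter_partial bs (fiber_integral \<phi>) x))"
        unfolding pullback_fst_eq[OF \<phi>(1)] I_def
        by (intro C test_function_fiber_integral \<phi>)
      also have "\<dots> \<le> C * (\<Sum>bs\<in>I. 2 * R * ?S)"
      proof (intro mult_left_mono sum_mono cSUP_least C)
        fix bs x assume bs: "bs \<in> I"
        \<comment> \<open>The only basis vector of the line is 1, so a list over it is determined by
          its length and corresponds to the same number of derivatives along
          \<open>(1, 0)\<close>.\<close>
        define bs' where "bs' = replicate (length bs) (1 :: real, 0 :: real)"
        have bs': "set bs' \<subseteq> Basis" "bs' \<in> J"
          using bs by (auto simp: bs'_def I_def J_def Basis_prod_def)
        have "bs = replicate (length bs) 1"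
          using bs by (intro replicate_eqI) (auto simp: I_def)
        then have "iter_partial bs (fiber_integral \<phi>) = fiber_integral (iter_partial bs' \<phi>)"
          using iter_partial_fiber_integral[OF \<phi>(1)] unfolding bs'_def by metis
        moreover have "cmod (fiber_integral (iter_partial bs' \<phi>) x)
            \<le> 2 * R * (SUP p. cmod (iter_partial bs' \<phi> p))"
        proof (rule fiber_integral_bound[OF test_function_iter_partial[OF \<phi>(1) bs'(1)]])
          fix x y :: real assume "R < \<bar>y\<bar>"
          then have "(x, y) \<notin> K" using R(2)[of "(x, y)"] norm_snd_le[of y x] by force
          then have "(x, y) \<notin> supp (iter_partial bs' \<phi>)"
            using \<phi>(2) supp_iter_partial_subset[of bs' \<phi>] by blast
          then show "iter_partial bs' \<phi> (x, y) = 0" by (rule zero_outside_supp)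
        qed (use R in simp)
        moreover have "(SUP p. cmod (iter_partial bs' \<phi> p)) \<le> ?S"
          using bs'(2) by (intro member_le_sum[of _ _ "\<lambda>bs. SUP p. cmod (iter_partial bs \<phi> p)"])
            (auto simp: J_def finite_multiindices intro!: SUP_iter_partial_nonneg \<phi>)
        ultimately show "cmod (iter_partial bs (fiber_integral \<phi>) x) \<le> 2 * R * ?S"
          using R(1) by (simp only:) (erule order_trans, intro mult_left_mono, simp_all)
      qed auto
      also have "\<dots> = (C * (card I * (2 * R))) * ?S"
        by simp
      finally show ?thesis .
    qed
    then show ?thesis unfolding J_def by blast
  qed
  ultimately show ?thesis unfolding distributions_def by blast
qed

section \<open>The wave front set of the pull-back\<close>

lemma test_function_tensor:
  fixes \<phi> :: "'a::euclidean_space \<Rightarrow> complex" and \<psi> :: "'b::euclidean_space \<Rightarrow> complex"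
  assumes "\<phi> \<in> test_functions UNIV" "\<psi> \<in> test_functions UNIV"
  shows "(\<lambda>p. \<phi> (fst p) * \<psi> (snd p)) \<in> test_functions UNIV"
proof (rule test_functionI[of _ "supp \<phi> \<times> supp \<psi>"])
  have "smooth (\<lambda>p::'a \<times> 'b. \<phi> (fst p + 0))" "smooth (\<lambda>p::'a \<times> 'b. \<psi> (snd p + 0))"
    by (intro smooth_compose_affine test_function_smooth[OF assms(1)]
        test_function_smooth[OF assms(2)] linear_fst linear_snd)+
  then show "smooth (\<lambda>p. \<phi> (fst p) * \<psi> (snd p))"
    by (intro smooth_mult) simp_all
  show "compact (supp \<phi> \<times> supp \<psi>)"
    by (intro compact_Times test_function_compact[OF assms(1)] test_function_compact[OF assms(2)])
  show "\<phi> (fst p) * \<psi> (snd p) = 0" if "p \<notin> supp \<phi> \<times> supp \<psi>" for p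
    using that zero_outside_supp[of "fst p" \<phi>] zero_outside_supp[of "snd p" \<psi>]
    by (auto simp: mem_Times_iff)
qed

text \<open>The exponential splits into one factor per variable, so the fibre integral is a number
  times a modulated \<open>\<phi>\<close>, and homogeneity of \<open>u\<close> moves the number
  outside.\<close>

lemma fourier_localize_pullback_fst:
  assumes u: "u \<in> distributions UNIV"
    and \<phi>: "\<phi> \<in> test_functions UNIV" and \<psi>: "\<psi> \<in> test_functions UNIV"
  shows "fourier (localize (pullback_fst u) (\<lambda>p. \<phi> (fst p) * \<psi> (snd p))) k
    = fourier_integral \<psi> (snd k) * u (\<lambda>x. \<phi> x * expi (fst k) x)"
proof -
  have "fiber_integral (\<lambda>p. \<phi> (fst p) * \<psi> (snd p) * expi k p)
      = (\<lambda>x. fourier_integral \<psi> (snd k) * (\<phi> x * expi (fst k) x))"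
  proof
    fix x
    have "(\<lambda>y. \<phi> x * \<psi> y * expi k (x, y))
        = (\<lambda>y. (\<phi> x * expi (fst k) x) * (\<psi> y * expi (snd k) y))"
      by (simp add: inner_prod_def distrib_left exp_add[symmetric] algebra_simps)
    then show "fiber_integral (\<lambda>p. \<phi> (fst p) * \<psi> (snd p) * expi k p) x
        = fourier_integral \<psi> (snd k) * (\<phi> x * expi (fst k) x)"
      unfolding fiber_integral_def fourier_integral_def fst_conv snd_conv
      by (simp only: integral_mult_right_zero mult.commute)
  qed
  moreover have "(\<lambda>p. \<phi> (fst p) * \<psi> (snd p) * expi k p) \<in> test_functions UNIV"
    by (intro test_function_mult test_function_tensor \<phi> \<psi> smooth_expi)
  moreover have "(\<lambda>x. \<phi> x * expi (fst k) x) \<in> test_functions UNIV"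
    by (intro test_function_mult \<phi> smooth_expi)
  ultimately show ?thesis
    by (simp only: fourier_def localize_def pullback_fst_eq distributions_cmult[OF u])
qed

lemma WF_pullback_fst:
  assumes u: "u \<in> distributions UNIV" and in_WF: "((x\<^sub>1, x\<^sub>2), (\<xi>\<^sub>1, \<xi>\<^sub>2)) \<in> WF UNIV (pullback_fst u)"
  shows "\<xi>\<^sub>2 = 0"
proof (rule ccontr)
  assume \<xi>: "\<xi>\<^sub>2 \<noteq> 0"
  let ?a = "\<lambda>t. complex_of_real (bump x\<^sub>1 t)" and ?b = "\<lambda>t. complex_of_real (bump x\<^sub>2 t)"
  let ?\<rho> = "\<lambda>p. ?a (fst p) * ?b (snd p)"
  \<comment> \<open>The summand 1 makes the inequality that places the covector in the open cone
    \<open>V\<close> strict: \<open>c * \<bar>\<xi>\<^sub>2\<bar> = \<bar>\<xi>\<^sub>1\<bar> +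
    \<bar>\<xi>\<^sub>2\<bar>\<close>.\<close>
  define c where "c = \<bar>\<xi>\<^sub>1\<bar> / \<bar>\<xi>\<^sub>2\<bar> + 1"
  have c: "c \<ge> 1" by (simp add: c_def)
  define V where "V = {k :: real \<times> real. \<bar>fst k\<bar> < c * \<bar>snd k\<bar>}"
  have "open V"
    unfolding V_def by (intro open_Collect_less continuous_intros)
  moreover have "positive_cone V"
    by (auto simp: positive_cone_def V_def abs_mult)
  moreover have "(\<xi>\<^sub>1, \<xi>\<^sub>2) \<in> V"
    using \<xi> by (simp add: V_def c_def distrib_right)
  moreover have "?\<rho> \<in> test_functions UNIV"
    by (intro test_function_tensor test_function_bump)
  moreover have "?\<rho> (x\<^sub>1, x\<^sub>2) \<noteq> 0"
    using bump_pos[of x\<^sub>1 x\<^sub>1] bump_pos[of x\<^sub>2 x\<^sub>2] by simp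
  moreover have "\<exists>C. \<forall>k\<in>V. (1 + norm k) ^ N * cmod (fourier (localize (pullback_fst u) ?\<rho>) k) \<le> C" for N
  proof -
    obtain A m where A: "A \<ge> 0" "\<And>k. cmod (u (\<lambda>x. ?a x * expi k x)) \<le> A * (1 + norm k) ^ m"
      using distribution_modulate_bound[OF u test_function_bump] by blast
    \<comment> \<open>Decay of order \<open>N + m\<close>: \<open>m\<close> powers absorb the growth
      of \<open>u\<close>, and \<open>N\<close> powers the weight.\<close>
    obtain B where B: "\<And>k. (1 + \<bar>k\<bar>) ^ (N + m) * cmod (fourier_integral ?b k) \<le> B"
      using fourier_integral_rapid_decay[OF test_function_bump] by blast
    have "(1 + norm k) ^ N * cmod (fourier (localize (pullback_fst u) ?\<rho>) k)
        \<le> A * (c + 1) ^ (N + m) * B" if "k \<in> V" for k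
    proof -
      \<comment> \<open>On \<open>V\<close> the second coordinate controls the whole covector, so
        both weights are at most \<open>(c + 1) * s\<close>.\<close>
      define s where "s = 1 + \<bar>snd k\<bar>"
      have "norm k \<le> \<bar>fst k\<bar> + \<bar>snd k\<bar>"
        using norm_Pair_le[of "fst k" "snd k"] by simp
      then have k: "1 + norm k \<le> (c + 1) * s" "1 + norm (fst k) \<le> (c + 1) * s"
        using that c by (auto simp: V_def s_def algebra_simps)
      have "(1 + norm k) ^ N * cmod (fourier (localize (pullback_fst u) ?\<rho>) k)
          = (1 + norm k) ^ N * cmod (u (\<lambda>x. ?a x * expi (fst k) x)) * cmod (fourier_integral ?b (snd k))"
        by (simp only: fourier_localize_pullback_fst[OF u test_function_bump test_function_bump]
            norm_mult mult_ac)
      also have "\<dots> \<le> ((c + 1) * s) ^ N * (A * ((c + 1) * s) ^ m) * cmod (fourier_integral ?b (snd k))"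
        using k A c by (intro mult_right_mono mult_mono power_mono order_trans[OF A(2)] mult_left_mono)
          (auto simp: s_def)
      also have "\<dots> = A * (c + 1) ^ (N + m) * (s ^ (N + m) * cmod (fourier_integral ?b (snd k)))"
        by (simp add: power_add power_mult_distrib)
      also have "\<dots> \<le> A * (c + 1) ^ (N + m) * B"
        unfolding s_def using A(1) c by (intro mult_left_mono B) auto
      finally show ?thesis .
    qed
    then show ?thesis by blast
  qed
  ultimately have "\<exists>\<rho>\<in>test_functions UNIV. \<exists>V. \<rho> (x\<^sub>1, x\<^sub>2) \<noteq> 0 \<and> open V \<and> positive_cone V \<and> (\<xi>\<^sub>1, \<xi>\<^sub>2) \<in> V \<and>
      (\<forall>N::nat. \<exists>C. \<forall>k\<in>V. (1 + norm k) ^ N * cmod (fourier (localize (pullback_fst u) \<rho>) k) \<le> C)"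
    by (intro bexI[of _ ?\<rho>] exI[of _ V] conjI allI)
  then show False using in_WF unfolding WF_def by blast
qed

lemma adjoint_fst:
  "adjoint (fst :: real \<times> real \<Rightarrow> real) = (\<lambda>\<eta>. (\<eta>, 0))"
  by (rule adjoint_unique) (simp add: inner_prod_def)

lemma pullback_cone_fst:
  "pullback_cone (fst :: real \<times> real \<Rightarrow> real) (punctured_cotangent UNIV)
    = {((x\<^sub>1, x\<^sub>2), (\<xi>\<^sub>1, 0)) | x\<^sub>1 x\<^sub>2 \<xi>\<^sub>1. \<xi>\<^sub>1 \<noteq> 0}"
proof -
  have "frechet_derivative fst (at x) = (fst :: real \<times> real \<Rightarrow> real)" for x
    by (intro frechet_derivative_eqI bounded_linear_imp_has_derivative bounded_linear_fst)
  then show ?thesis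
    by (auto simp: pullback_cone_def punctured_cotangent_def adjoint_fst)
qed

lemma pullback_fst_WF:
  assumes "u \<in> distributions UNIV"
  shows "pullback_fst u \<in> distributions_WF UNIV (pullback_cone fst (punctured_cotangent UNIV))"
proof -
  have "p \<in> {((x\<^sub>1, x\<^sub>2), (\<xi>\<^sub>1, 0)) | x\<^sub>1 x\<^sub>2 \<xi>\<^sub>1. \<xi>\<^sub>1 \<noteq> 0}" if p: "p \<in> WF UNIV (pullback_fst u)" for p
  proof -
    obtain x\<^sub>1 x\<^sub>2 \<xi>\<^sub>1 \<xi>\<^sub>2 where p_eq: "p = ((x\<^sub>1, x\<^sub>2), (\<xi>\<^sub>1, \<xi>\<^sub>2))" by (metis surj_pair)
    have "\<xi>\<^sub>2 = 0" using WF_pullback_fst[OF assms] p p_eq by blast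
    moreover have "(\<xi>\<^sub>1, \<xi>\<^sub>2) \<noteq> 0" using p by (auto simp: p_eq WF_def punctured_cotangent_def)
    ultimately show ?thesis by (auto simp: p_eq zero_prod_def)
  qed
  then show ?thesis
    unfolding pullback_cone_fst distributions_WF_def
    using pullback_fst_distribution[OF assms] by blast
qed

section \<open>Failure of continuity\<close>

text \<open>Each seminorm for the full cone depends on the values at finitely many functions only.
  The resulting property of a set at each of its points passes to finite intersections and to
  unions, hence to every open set.\<close>

lemma openin_hormander_topology_full_cone:
  fixes u :: "'a::euclidean_space functional"
  assumes "openin (hormander_topology UNIV (punctured_cotangent UNIV)) U" "u \<in> U"
  shows "\<exists>F. finite F \<and>
    (\<forall>v\<in>distributions_WF UNIV (punctured_cotangent UNIV). (\<forall>\<phi>\<in>F. v \<phi> = u \<phi>) \<longrightarrow> v \<in> U)"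
proof -
  let ?\<Gamma> = "punctured_cotangent UNIV :: ('a \<times> 'a) set"
  let ?E = "distributions_WF UNIV ?\<Gamma>"
  have "\<forall>u\<in>U. \<exists>F. finite F \<and> (\<forall>v\<in>?E. (\<forall>\<phi>\<in>F. v \<phi> = u \<phi>) \<longrightarrow> v \<in> U)"
    using assms(1)
    unfolding hormander_topology_def seminorm_topology_def openin_topology_generated_by_iff
  proof induction
    case Empty
    then show ?case by blast
  next
    case (Int a b)
    show ?case
    proof
      fix u assume "u \<in> a \<inter> b"
      then obtain F G where "finite F" "\<forall>v\<in>?E. (\<forall>\<phi>\<in>F. v \<phi> = u \<phi>) \<longrightarrow> v \<in> a"
          "finite G" "\<forall>v\<in>?E. (\<forall>\<phi>\<in>G. v \<phi> = u \<phi>) \<longrightarrow> v \<in> b"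
        using Int.IH by (metis IntE)
      then show "\<exists>F. finite F \<and> (\<forall>v\<in>?E. (\<forall>\<phi>\<in>F. v \<phi> = u \<phi>) \<longrightarrow> v \<in> a \<inter> b)"
        by (intro exI[of _ "F \<union> G"]) simp
    qed
  next
    case (UN K)
    show ?case
    proof
      fix u assume "u \<in> \<Union>K"
      then obtain k where "k \<in> K" "u \<in> k" by blast
      with UN.IH show "\<exists>F. finite F \<and> (\<forall>v\<in>?E. (\<forall>\<phi>\<in>F. v \<phi> = u \<phi>) \<longrightarrow> v \<in> \<Union>K)"
        by (meson UnionI)
    qed
  next
    case (Basis s)
    then obtain p u\<^sub>0 \<epsilon> where p: "p \<in> hormander_seminorms UNIV ?\<Gamma>"
      and s: "s = {v \<in> ?E. p (\<lambda>\<phi>. v \<phi> - u\<^sub>0 \<phi>) < ennreal \<epsilon>}" by blast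
    have "\<exists>F. finite F \<and> (\<forall>u v. (\<forall>\<phi>\<in>F. v \<phi> = u \<phi>) \<longrightarrow>
        p (\<lambda>\<phi>. v \<phi> - u\<^sub>0 \<phi>) = p (\<lambda>\<phi>. u \<phi> - u\<^sub>0 \<phi>))"
      using p unfolding hormander_seminorms_def
    proof (elim UnE CollectE exE conjE)
      fix \<phi> :: "'a \<Rightarrow> complex" assume "p = weak_seminorm \<phi>"
      then show ?thesis by (intro exI[of _ "{\<phi>}"]) (simp add: weak_seminorm_def)
    next
      fix N V and \<rho> :: "'a \<Rightarrow> complex"
      assume p: "p = cone_seminorm N V \<rho>" and disj: "supp \<rho> \<times> V \<inter> ?\<Gamma> = {}"
      define F where "F = (\<lambda>k x. \<rho> x * expi k x) ` V"
      \<comment> \<open>If \<open>V\<close> lies in \<open>{0}\<close>, one frequency remains.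
        Otherwise \<open>V\<close> contains a nonzero covector, disjointness makes
        \<open>supp \<rho>\<close> empty, and \<open>F\<close> contains at most the zero
        function.\<close>
      have "finite F"
      proof (cases "V \<subseteq> {0}")
        case True
        then show ?thesis unfolding F_def by (meson finite.simps finite_imageI finite_subset)
      next
        case False
        then have "supp \<rho> = {}" using disj by (auto simp: punctured_cotangent_def)
        then have "\<rho> x = 0" for x by (intro zero_outside_supp) simp
        then have "F \<subseteq> {\<lambda>_. 0}" unfolding F_def by auto
        then show ?thesis by (rule finite_subset) simp
      qed
      moreover have "p (\<lambda>\<phi>. v \<phi> - u\<^sub>0 \<phi>) = p (\<lambda>\<phi>. u \<phi> - u\<^sub>0 \<phi>)"
        if "\<forall>\<phi>\<in>F. v \<phi> = u \<phi>" for u v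
        unfolding p cone_seminorm_def
        by (intro SUP_cong refl) (use that in \<open>simp add: F_def fourier_def localize_def\<close>)
      ultimately show ?thesis by blast
    qed
    then show ?case unfolding s by (metis (no_types, lifting) mem_Collect_eq)
  qed
  then show ?thesis using assms(2) by blast
qed

section \<open>Linear algebra: underdetermined systems and power sums\<close>

lemma exists_nontrivial_annihilator:
  fixes g :: "'i \<Rightarrow> 'x \<Rightarrow> 'f::field"
  assumes "finite J" "finite X" "card J < card X"
  shows "\<exists>c. (\<exists>x\<in>X. c x \<noteq> 0) \<and> (\<forall>j\<in>J. (\<Sum>x\<in>X. c x * g j x) = 0)"
  using assms
proof (induction J arbitrary: g X rule: finite_induct)
  case empty
  then show ?case by (intro exI[of _ "\<lambda>_. 1"]) (auto simp: card_gt_0_iff)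
next
  case (insert i J)
  show ?case
  proof (cases "\<forall>x\<in>X. g i x = 0")
    case True
    have "card J < card X" using insert by simp
    from insert.IH[OF insert.prems(1) this, of g] show ?thesis using True by auto
  next
    case False
    then obtain y where y: "y \<in> X" "g i y \<noteq> 0" by blast
    \<comment> \<open>Gaussian elimination: \<open>h j\<close> is equation \<open>j\<close> minus
      the multiple of equation \<open>i\<close> that removes the unknown \<open>y\<close>.\<close>
    define h where "h j x = g j x - g j y / g i y * g i x" for j x
    have "card J < card (X - {y})" using insert y by simp
    then obtain c where c: "\<exists>x\<in>X - {y}. c x \<noteq> 0"
        "\<And>j. j \<in> J \<Longrightarrow> (\<Sum>x\<in>X - {y}. c x * h j x) = 0"
      using insert.IH[of "X - {y}" h] insert.prems(1) by blast
    \<comment> \<open>The value at \<open>y\<close> is found by solving equation \<open>i\<close>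
      for it. The sums over \<open>X\<close> then equal the reduced ones, and for \<open>i\<close>
      the reduced sum vanishes since \<open>h i\<close> does.\<close>
    define c' where "c' = c(y := - (\<Sum>x\<in>X - {y}. c x * g i x) / g i y)"
    have c'_sum: "(\<Sum>x\<in>X. c' x * g j x) = (\<Sum>x\<in>X - {y}. c x * h j x)" for j
    proof -
      have "(\<Sum>x\<in>X. c' x * g j x) = c' y * g j y + (\<Sum>x\<in>X - {y}. c x * g j x)"
        by (subst sum.remove[OF insert.prems(1) y(1)]) (auto simp: c'_def intro!: sum.cong)
      also have "\<dots> = (\<Sum>x\<in>X - {y}. c x * h j x)"
        by (simp add: c'_def h_def algebra_simps sum_subtractf sum_distrib_left sum_divide_distrib)
      finally show ?thesis .
    qed
    have "h i x = 0" for x using y by (simp add: h_def)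
    then have "\<forall>j\<in>insert i J. (\<Sum>x\<in>X. c' x * g j x) = 0"
      using c(2) by (auto simp: c'_sum)
    moreover have "\<exists>x\<in>X. c' x \<noteq> 0" using c(1) by (auto simp: c'_def)
    ultimately show ?thesis by blast
  qed
qed

text \<open>A Vandermonde argument by interpolation: the polynomial with roots at the nodes other
  than \<open>z y\<close> would turn vanishing power sums into
  \<open>d y * poly p (z y) = 0\<close>, although both factors are nonzero.\<close>

lemma power_sums_not_all_zero:
  fixes z d :: "'x \<Rightarrow> 'f::field"
  assumes "finite X" "inj_on z X" "y \<in> X" "d y \<noteq> 0"
  shows "\<exists>l\<le>card X. (\<Sum>x\<in>X. d x * z x ^ l) \<noteq> 0"
proof (rule ccontr)
  assume *: "\<not> ?thesis"
  define p where "p = (\<Prod>x\<in>X - {y}. [:- z x, 1:])"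
  have "degree p \<le> (\<Sum>x\<in>X - {y}. degree [:- z x, 1:])"
    unfolding p_def using assms(1) by (intro degree_prod_sum_le[unfolded o_def]) simp
  also have "\<dots> \<le> card X" by (simp add: card_mono assms(1) card_Diff1_le)
  finally have deg: "degree p \<le> card X" .
  have root: "poly p (z x) = 0" if "x \<in> X - {y}" for x
    using that assms(1) by (auto simp: p_def poly_prod)
  have "d y * poly p (z y) = (\<Sum>x\<in>X. d x * poly p (z x))"
    using root by (subst sum.remove[OF assms(1,3)]) simp
  also have "\<dots> = (\<Sum>x\<in>X. \<Sum>l\<le>degree p. coeff p l * (d x * z x ^ l))"
    by (simp add: poly_altdef sum_distrib_left mult.left_commute)
  also have "\<dots> = (\<Sum>l\<le>degree p. coeff p l * (\<Sum>x\<in>X. d x * z x ^ l))"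
    by (subst sum.swap) (simp add: sum_distrib_left)
  also have "\<dots> = 0" using * deg by (intro sum.neutral) auto
  finally have "poly p (z y) = 0" using assms(4) by simp
  then show False
    using assms by (auto simp: p_def poly_prod dest: inj_onD)
qed

section \<open>Combinations of point masses\<close>

definition point_masses ::
    "'a::euclidean_space set \<Rightarrow> ('a \<Rightarrow> complex) \<Rightarrow> 'a functional" where
  "point_masses X c = (\<lambda>\<phi>\<in>test_functions UNIV. \<Sum>x\<in>X. c x * \<phi> x)"

text \<open>The order is 0, and the empty list is the only multi-index of that order. For infinite
  \<open>X\<close> the sums are 0 by convention and the bound still holds.\<close>

lemma point_masses_distribution:
  fixes X :: "'a::euclidean_space set"
  shows "point_masses X c \<in> distributions UNIV"
proof -
  have "cmod (point_masses X c \<phi>) \<le> (\<Sum>x\<in>X. cmod (c x)) *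
      (\<Sum>bs | set bs \<subseteq> Basis \<and> length bs \<le> 0. SUP x. cmod (iter_partial bs \<phi> x))"
    if \<phi>: "\<phi> \<in> test_functions UNIV" for \<phi>
  proof -
    have "{bs :: 'a list. set bs \<subseteq> Basis \<and> length bs \<le> 0} = {[]}" by auto
    moreover have "cmod (\<Sum>x\<in>X. c x * \<phi> x) \<le> (\<Sum>x\<in>X. cmod (c x)) * (SUP x. cmod (\<phi> x))"
      unfolding sum_distrib_right
      by (intro sum_norm_le) (simp add: norm_mult mult_left_mono cmod_le_SUP[OF \<phi>])
    ultimately show ?thesis using \<phi> by (simp add: point_masses_def)
  qed
  moreover have "point_masses X c \<in> extensional (test_functions UNIV)"
    by (simp add: point_masses_def)
  moreover have "point_masses X c (\<lambda>x. \<phi> x + \<psi> x) = point_masses X c \<phi> + point_masses X c \<psi>"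
    if "\<phi> \<in> test_functions UNIV" "\<psi> \<in> test_functions UNIV" for \<phi> \<psi>
    using that by (simp add: point_masses_def test_function_add distrib_left sum.distrib)
  moreover have "point_masses X c (\<lambda>x. a * \<phi> x) = a * point_masses X c \<phi>"
    if "\<phi> \<in> test_functions UNIV" for a \<phi>
    using that
    by (simp add: point_masses_def test_function_cmult sum_distrib_left mult.left_commute)
  ultimately show ?thesis
    unfolding distributions_def by blast
qed

text \<open>The real part of the integrand is \<open>bump 0 t * cos t\<close>. It is continuous,
  nonnegative on \<open>{-1..1}\<close> since 1 < pi/2, and positive at 0.\<close>

lemma fourier_integral_bump_nonzero:
  "fourier_integral (\<lambda>t. complex_of_real (bump 0 t)) 1 \<noteq> 0"
proof
  let ?h = "\<lambda>t. complex_of_real (bump 0 t) * expi 1 t"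
  assume zero: "fourier_integral (\<lambda>t. complex_of_real (bump 0 t)) 1 = 0"
  have h: "?h \<in> test_functions UNIV"
    by (intro test_function_mult test_function_bump smooth_expi)
  have "fourier_integral (\<lambda>t. complex_of_real (bump 0 t)) 1 = integral (cbox (-1) 1) ?h"
    unfolding fourier_integral_def
    by (rule lborel_integral_eq_cbox[OF h]) (auto intro!: bump_eq_0)
  moreover have "?h integrable_on cbox (-1) 1"
    by (intro integrable_continuous smooth_continuous_on test_function_smooth[OF h])
  ultimately have "(?h has_integral 0) {-1..1}"
    using zero integrable_integral by fastforce
  from has_integral_linear[OF this bounded_linear_Re]
  have "integral {-1..1} (Re \<circ> ?h) = 0" by (auto simp: integral_unique)
  moreover have "continuous_on {-1..1} (Re \<circ> ?h)"
    by (intro continuous_on_compose continuous_on_Re continuous_on_id smooth_continuous_on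
        test_function_smooth[OF h])
  moreover have "(Re \<circ> ?h) t \<ge> 0" if "t \<in> {-1..1}" for t
    using that pi_gt3 by (auto simp: Re_exp intro!: mult_nonneg_nonneg bump_nonneg cos_ge_zero)
  ultimately have "(Re \<circ> ?h) 0 = 0"
    by (subst (asm) integral_eq_0_iff) auto
  then show False using bump_pos[of 0 0] by simp
qed

text \<open>With one more point than \<open>F\<close> has elements, some nontrivial coefficients
  annihilate \<open>F\<close>. Tested against the modulated bump at frequencies l/n, they give power
  sums, which cannot all vanish for l \<le> n. Scaling then produces \<open>r\<close>.\<close>

lemma exists_point_masses:
  fixes F :: "(real \<Rightarrow> complex) set"
  assumes "finite F" and r: "r \<noteq> 0"
  shows "\<exists>X c k. 0 \<le> k \<and> k \<le> 1 \<and> (\<forall>\<phi>\<in>F. (\<Sum>x\<in>X. c x * \<phi> x) = 0) \<and>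
    point_masses X c (\<lambda>t. complex_of_real (bump 0 t) * expi k t) = r"
proof -
  define n where "n = Suc (card F)"
  \<comment> \<open>The points lie in [0, 1), where the bump is positive, so weighting by the bump
    keeps a nonzero coefficient nonzero.\<close>
  define X where "X = (\<lambda>i. real i / n) ` {..<n}"
  have X: "finite X" "card X = n" "\<And>x. x \<in> X \<Longrightarrow> 0 \<le> x \<and> x < 1"
    by (auto simp: X_def n_def inj_on_def card_image)
  obtain c y where y: "y \<in> X" "c y \<noteq> 0" and c: "\<And>\<phi>. \<phi> \<in> F \<Longrightarrow> (\<Sum>x\<in>X. c x * \<phi> x) = 0"
    using exists_nontrivial_annihilator[OF assms(1) X(1), of "\<lambda>\<phi>. \<phi>"] X(2)
    by (auto simp: n_def)
  \<comment> \<open>The powers \<open>z x ^ l\<close> are exponentials of frequency l/n, so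
    exponents up to \<open>n\<close> keep the frequency in [0, 1].\<close>
  define z where "z = expi (1 / real n)"
  have "inj_on z X"
  proof (rule inj_onI)
    fix s t assume st: "s \<in> X" "t \<in> X" "z s = z t"
    \<comment> \<open>Exponents closer than 2 pi cannot differ by a period, so equal exponentials
      force equal points.\<close>
    have "\<bar>s / n - t / n\<bar> \<le> 1"
    proof -
      have "\<bar>s - t\<bar> \<le> 1" using X(3)[OF st(1)] X(3)[OF st(2)] by linarith
      then show ?thesis by (simp add: n_def field_simps flip: diff_divide_distrib)
    qed
    then have "\<bar>s / n - t / n\<bar> < 2 * pi" using pi_gt3 by linarith
    then have "\<bar>Im (- \<i> * complex_of_real ((1 / real n) \<bullet> s))
        - Im (- \<i> * complex_of_real ((1 / real n) \<bullet> t))\<bar> < 2 * pi"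
      by (simp add: abs_minus_commute)
    then have "- \<i> * complex_of_real ((1 / real n) \<bullet> s) = - \<i> * complex_of_real ((1 / real n) \<bullet> t)"
      using st(3)[unfolded z_def] by (rule exp_complex_eqI)
    from arg_cong[OF this, of Im] show "s = t" by (simp add: n_def)
  qed
  moreover have "c y * complex_of_real (bump 0 y) \<noteq> 0"
    using y(2) X(3)[OF y(1)] bump_pos[of y 0] by simp
  ultimately obtain l where l: "l \<le> n" "(\<Sum>x\<in>X. c x * complex_of_real (bump 0 x) * z x ^ l) \<noteq> 0"
    using power_sums_not_all_zero[OF X(1) _ y(1), of z "\<lambda>x. c x * complex_of_real (bump 0 x)"] X(2)
    by auto
  define k where "k = real l / n"
  have zl: "z x ^ l = expi k x" for x
    by (simp add: z_def k_def exp_of_nat_mult[symmetric] algebra_simps)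
  define S where "S = (\<Sum>x\<in>X. c x * (complex_of_real (bump 0 x) * expi k x))"
  have S: "S \<noteq> 0" using l(2) by (simp only: S_def zl mult.assoc not_False_eq_True)
  show ?thesis
  proof (intro exI[of _ X] exI[of _ "\<lambda>x. r / S * c x"] exI[of _ k] conjI ballI)
    show "0 \<le> k" "k \<le> 1" using l(1) by (auto simp: k_def n_def)
    show "(\<Sum>x\<in>X. r / S * c x * \<phi> x) = 0" if "\<phi> \<in> F" for \<phi>
      using c[OF that] by (simp only: mult.assoc flip: sum_distrib_left) simp
    have "(\<lambda>t. complex_of_real (bump 0 t) * expi k t) \<in> test_functions UNIV"
      by (intro test_function_mult test_function_bump smooth_expi)
    then have "point_masses X (\<lambda>x. r / S * c x) (\<lambda>t. complex_of_real (bump 0 t) * expi k t)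
        = (\<Sum>x\<in>X. r / S * c x * (complex_of_real (bump 0 x) * expi k x))"
      unfolding point_masses_def restrict_def by (rule if_P)
    also have "\<dots> = r / S * S"
      unfolding S_def sum_distrib_left by (simp only: mult.assoc)
    finally show "point_masses X (\<lambda>x. r / S * c x) (\<lambda>t. complex_of_real (bump 0 t) * expi k t) = r"
      using S by simp
  qed
qed

section \<open>The contradiction\<close>

lemma distributions_WF_full_cone:
  "distributions_WF UNIV (punctured_cotangent UNIV) = distributions UNIV"
  by (auto simp: distributions_WF_def WF_def)

lemma not_continuous_pullback_fst:
  "\<not> continuous_map (hormander_topology UNIV (punctured_cotangent UNIV))
    (hormander_topology UNIV (pullback_cone fst (punctured_cotangent UNIV))) pullback_fst"
proof
  let ?E = "distributions_WF UNIV (pullback_cone fst (punctured_cotangent UNIV)) :: (real \<times> real) functional set"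
  let ?b = "\<lambda>t. complex_of_real (bump 0 t)"
  let ?\<rho> = "\<lambda>p. ?b (fst p) * ?b (snd p)"
  assume cont: "continuous_map (hormander_topology UNIV (punctured_cotangent UNIV))
    (hormander_topology UNIV (pullback_cone fst (punctured_cotangent UNIV))) pullback_fst"
  \<comment> \<open>A covector of \<open>V\<close> with second coordinate 0 is 0, so
    \<open>V\<close> misses the pulled-back cone and gives an admissible seminorm.\<close>
  define V where "V = {k :: real \<times> real. \<bar>fst k\<bar> \<le> \<bar>snd k\<bar>}"
  define p where "p = cone_seminorm 0 V ?\<rho>"
  \<comment> \<open>The zero distribution. By extensionality it is \<open>undefined\<close> off the
    test functions, which the empty sum of point masses respects.\<close>
  define o\<^sub>1 where "o\<^sub>1 = point_masses {} (\<lambda>_::real. 0)"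
  define U where "U = {v \<in> ?E. p (\<lambda>\<phi>. v \<phi> - pullback_fst o\<^sub>1 \<phi>) < ennreal 1}"
  have o: "o\<^sub>1 \<in> distributions UNIV"
    unfolding o\<^sub>1_def by (rule point_masses_distribution)
  have "closed V" unfolding V_def by (intro closed_Collect_le continuous_intros)
  moreover have "positive_cone V" by (auto simp: positive_cone_def V_def abs_mult)
  moreover have "supp ?\<rho> \<times> V \<inter> pullback_cone fst (punctured_cotangent UNIV) = {}"
    by (auto simp: pullback_cone_fst V_def)
  moreover have "?\<rho> \<in> test_functions UNIV"
    by (intro test_function_tensor test_function_bump)
  ultimately have "p \<in> hormander_seminorms UNIV (pullback_cone fst (punctured_cotangent UNIV))"
    unfolding hormander_seminorms_def p_def by blast
  then have "openin (hormander_topology UNIV (pullback_cone fst (punctured_cotangent UNIV))) U"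
    unfolding hormander_topology_def seminorm_topology_def U_def
    using pullback_fst_WF[OF o] zero_less_one by (intro topology_generated_by_Basis) blast
  then have preimage: "openin (hormander_topology UNIV (punctured_cotangent UNIV))
      {u \<in> distributions UNIV. pullback_fst u \<in> U}"
    using openin_continuous_map_preimage[OF cont]
    by (simp add: topspace_hormander_topology distributions_WF_full_cone)
  have "p (\<lambda>\<phi>. pullback_fst o\<^sub>1 \<phi> - pullback_fst o\<^sub>1 \<phi>) = 0"
    by (simp add: p_def cone_seminorm_def fourier_def localize_def bot_ennreal[symmetric])
  then have "o\<^sub>1 \<in> {u \<in> distributions UNIV. pullback_fst u \<in> U}"
    using o pullback_fst_WF[OF o] by (simp add: U_def)
  from openin_hormander_topology_full_cone[OF preimage this, unfolded distributions_WF_full_cone]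
  obtain F where F: "finite F"
      "\<And>v. v \<in> distributions UNIV \<Longrightarrow> \<forall>\<phi>\<in>F. v \<phi> = o\<^sub>1 \<phi> \<Longrightarrow> pullback_fst v \<in> U"
    by blast
  \<comment> \<open>This value cancels the factor from the second variable at \<open>(k, 1)\<close>,
    so the seminorm reaches 1, the radius of \<open>U\<close>.\<close>
  have "1 / fourier_integral ?b 1 \<noteq> 0" using fourier_integral_bump_nonzero by simp
  from exists_point_masses[OF F(1) this]
  obtain X c k where k: "0 \<le> k" "k \<le> 1"
    and c: "\<forall>\<phi>\<in>F. (\<Sum>x\<in>X. c x * \<phi> x) = 0"
    and w: "point_masses X c (\<lambda>t. ?b t * expi k t) = 1 / fourier_integral ?b 1"
    by (elim exE conjE)
  let ?w = "point_masses X c"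
  \<comment> \<open>\<open>F\<close> may contain functions that are not test functions; there both
    sides are \<open>undefined\<close>.\<close>
  have "\<forall>\<phi>\<in>F. ?w \<phi> = o\<^sub>1 \<phi>"
    using c by (simp add: point_masses_def o\<^sub>1_def restrict_def)
  then have "p (\<lambda>\<phi>. pullback_fst ?w \<phi> - pullback_fst o\<^sub>1 \<phi>) < 1"
    using F(2)[OF point_masses_distribution] by (simp add: U_def)
  moreover have "1 \<le> p (\<lambda>\<phi>. pullback_fst ?w \<phi> - pullback_fst o\<^sub>1 \<phi>)"
  proof -
    have o_zero: "o\<^sub>1 (\<lambda>t. ?b t * expi k t) = 0"
      by (simp only: o\<^sub>1_def point_masses_def restrict_apply' test_function_mult test_function_bump
          smooth_expi sum.empty)
    have "fourier (localize (\<lambda>\<phi>. pullback_fst ?w \<phi> - pullback_fst o\<^sub>1 \<phi>) ?\<rho>) (k, 1)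
        = fourier (localize (pullback_fst ?w) ?\<rho>) (k, 1) - fourier (localize (pullback_fst o\<^sub>1) ?\<rho>) (k, 1)"
      by (simp only: fourier_def localize_def)
    also have "\<dots> = 1"
      using fourier_integral_bump_nonzero
      by (simp only: fourier_localize_pullback_fst[OF point_masses_distribution test_function_bump test_function_bump]
          fourier_localize_pullback_fst[OF o test_function_bump test_function_bump] fst_conv snd_conv w o_zero) simp
    finally have "ennreal ((1 + norm (k, 1::real)) ^ 0
        * cmod (fourier (localize (\<lambda>\<phi>. pullback_fst ?w \<phi> - pullback_fst o\<^sub>1 \<phi>) ?\<rho>) (k, 1))) = 1"
      by simp
    moreover have "(k, 1) \<in> V" using k by (simp add: V_def)
    ultimately show ?thesis unfolding p_def cone_seminorm_def by (metis (no_types, lifting) SUP_upper)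
  qed
  ultimately show False by simp
qed

text \<open>\<open>continuous_map\<close> also demands that the map send carrier to carrier. The
  third conjunct establishes this, so the negation in the last one really concerns preimages of open
  sets.\<close>

theorem proposition2p1:
  fixes f :: "real \<times> real \<Rightarrow> real"
    and \<Gamma> :: "(real \<times> real) set"
    and pullback :: "real functional \<Rightarrow> (real \<times> real) functional"
  assumes f: "f = (\<lambda>(x\<^sub>1, x\<^sub>2). x\<^sub>1)"
    and Gamma: "\<Gamma> = punctured_cotangent UNIV"
    and pullback: "pullback =
      (\<lambda>u. tensor_distribution UNIV UNIV u (function_distribution UNIV (\<lambda>_. 1)))"
  shows "distributions_WF UNIV \<Gamma> = distributions UNIV \<and>
    pullback_cone f \<Gamma> = {((x\<^sub>1, x\<^sub>2), (\<xi>\<^sub>1, 0)) | x\<^sub>1 x\<^sub>2 \<xi>\<^sub>1. \<xi>\<^sub>1 \<noteq> 0} \<and>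
    pullback \<in> distributions_WF UNIV \<Gamma> \<rightarrow> distributions_WF UNIV (pullback_cone f \<Gamma>) \<and>
    \<not> continuous_map (hormander_topology UNIV \<Gamma>)
        (hormander_topology UNIV (pullback_cone f \<Gamma>)) pullback"
proof -
  have "f = fst" by (auto simp: f)
  then show ?thesis
    unfolding Gamma pullback
    using pullback_fst_WF not_continuous_pullback_fst
    by (simp add: distributions_WF_full_cone pullback_cone_fst)
qed

end
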